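(* Let $G$ be a connected Lie group, and let $R$ and $S$ be finite-dimensional quantum systems each carrying a continuous (possibly projective) unitary representation $g\mapsto U^R_g$, $g\mapsto U^S_g$ of $G$. Let $\rho_R$ be any state on $R$, let $\rho_S$ be a $G$-symmetric state on $S$, and let $\mathcal{E}$ be a $G$-covariant channel on $RS$ such that $\mathcal{E}(\rho_R\otimes\rho_S)=\rho_R|\rho'_S$. Then $\rho'_S$ is $G$-symmetric. That is, $G$-asymmetry broadcasting is impossible for every connected Lie group $G$.
   Context: A channel is a completely positive trace-preserving map. Write $\mathcal{U}^X_g(\sigma)=U^X_g\sigma (U^X_g)^\dagger$. A state $\sigma_X$ is $G$-symmetric if $\mathcal{U}^X_g(\sigma_X)=\sigma_X$ for all $g\in G$, and $G$-asymmetric otherwise. A channel $\mathcal{E}$ on $RS$ is $G$-covariant if $\mathcal{E}\circ(\mathcal{U}^R_g\otimes\mathcal{U}^S_g)=(\mathcal{U}^R_g\otimes\mathcal{U}^S_g)\circ\mathcal{E}$ for all $g\in G$. The notation $\rho_R|\rho'_S$ denotes some (possibly correlated) bipartite state on $RS$ whose reduced states are $\rho_R$ on $R$ and $\rho'_S$ on $S$. "$R$ can broadcast $G$-asymmetry" means there exist a $G$-symmetric $\rho_S$ and a $G$-covariant $\mathcal{E}$ with $\mathcal{E}(\rho_R\otimes\rho_S)=\rho_R|\rho'_S$ and $\rho'_S$ $G$-asymmetric. *)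

theory Defs
  imports "HOL-Analysis.Analysis" "HOL-Algebra.Group" "Jordan_Normal_Form.Matrix"
begin

definition dagger :: "complex mat \<Rightarrow> complex mat" where
  "dagger A = mat (dim_col A) (dim_row A) (\<lambda>(i,j). cnj (A $$ (j,i)))"

definition mtrace :: "complex mat \<Rightarrow> complex" where
  "mtrace A = (\<Sum>i<dim_row A. A $$ (i,i))"

definition psd :: "nat \<Rightarrow> complex mat \<Rightarrow> bool" where
  "psd d A \<longleftrightarrow> A \<in> carrier_mat d d \<and> dagger A = A \<and>
     (\<forall>v :: nat \<Rightarrow> complex.
        0 \<le> Re (\<Sum>i<d. \<Sum>j<d. cnj (v i) * A $$ (i,j) * v j))"

definition density :: "nat \<Rightarrow> complex mat \<Rightarrow> bool" where
  "density d \<rho> \<longleftrightarrow> psd d \<rho> \<and> mtrace \<rho> = 1"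

definition unitary_mat :: "nat \<Rightarrow> complex mat \<Rightarrow> bool" where
  "unitary_mat d U \<longleftrightarrow> U \<in> carrier_mat d d \<and> dagger U * U = 1\<^sub>m d \<and> U * dagger U = 1\<^sub>m d"

text \<open>Kronecker (tensor) product; index (i,k) of the composite is i * dim2 + k.\<close>
definition kron :: "complex mat \<Rightarrow> complex mat \<Rightarrow> complex mat" where
  "kron A B = mat (dim_row A * dim_row B) (dim_col A * dim_col B)
     (\<lambda>(i,j). A $$ (i div dim_row B, j div dim_col B) * B $$ (i mod dim_row B, j mod dim_col B))"

definition ptrace_R :: "nat \<Rightarrow> nat \<Rightarrow> complex mat \<Rightarrow> complex mat" where
  "ptrace_R dR dS X = mat dS dS (\<lambda>(i,j). \<Sum>k<dR. X $$ (k*dS + i, k*dS + j))"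

definition ptrace_S :: "nat \<Rightarrow> nat \<Rightarrow> complex mat \<Rightarrow> complex mat" where
  "ptrace_S dR dS X = mat dR dR (\<lambda>(i,j). \<Sum>k<dS. X $$ (i*dS + k, j*dS + k))"

text \<open>Action of (E tensor id_k) on a (d*k) x (d*k) matrix, the ancilla index being the fast one.\<close>
definition ext_id :: "nat \<Rightarrow> nat \<Rightarrow> (complex mat \<Rightarrow> complex mat) \<Rightarrow> complex mat \<Rightarrow> complex mat" where
  "ext_id d k E X = mat (d*k) (d*k) (\<lambda>(p,q).
      E (mat d d (\<lambda>(i,j). X $$ (i*k + p mod k, j*k + q mod k))) $$ (p div k, q div k))"

definition channel :: "nat \<Rightarrow> (complex mat \<Rightarrow> complex mat) \<Rightarrow> bool" where
  "channel d E \<longleftrightarrow>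
     (\<forall>X \<in> carrier_mat d d. E X \<in> carrier_mat d d) \<and>
     (\<forall>X \<in> carrier_mat d d. \<forall>Y \<in> carrier_mat d d. \<forall>c::complex.
        E (c \<cdot>\<^sub>m X + Y) = c \<cdot>\<^sub>m E X + E Y) \<and>
     (\<forall>k. \<forall>X. psd (d*k) X \<longrightarrow> psd (d*k) (ext_id d k E X)) \<and>
     (\<forall>X \<in> carrier_mat d d. mtrace (E X) = mtrace X)"

definition connected_topological_group :: "('g, 'b) monoid_scheme \<Rightarrow> 'g topology \<Rightarrow> bool" where
  "connected_topological_group G T \<longleftrightarrow> group G \<and> topspace T = carrier G \<and>
     continuous_map (prod_topology T T) T (\<lambda>(x,y). x \<otimes>\<^bsub>G\<^esub> y) \<and>
     continuous_map T T (\<lambda>x. inv\<^bsub>G\<^esub> x) \<and> connected_space T"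

definition conj_by :: "complex mat \<Rightarrow> complex mat \<Rightarrow> complex mat" where
  "conj_by U \<sigma> = U * \<sigma> * dagger U"

text \<open>Continuous (possibly projective) unitary representation of G on C^d:
  U_{gh} equals U_g U_h up to a phase; continuity is continuity into the projective
  unitary group, i.e. of g \<mapsto> U_g X U_g^dagger for every X.\<close>
definition proj_unitary_rep :: "('g, 'b) monoid_scheme \<Rightarrow> 'g topology \<Rightarrow> nat \<Rightarrow> ('g \<Rightarrow> complex mat) \<Rightarrow> bool" where
  "proj_unitary_rep G T d U \<longleftrightarrow>
     (\<forall>g \<in> carrier G. unitary_mat d (U g)) \<and>
     (\<forall>g \<in> carrier G. \<forall>h \<in> carrier G. \<exists>c::complex. cmod c = 1 \<and>
        U (g \<otimes>\<^bsub>G\<^esub> h) = c \<cdot>\<^sub>m (U g * U h)) \<and>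
     (\<forall>X \<in> carrier_mat d d. \<forall>i<d. \<forall>j<d.
        continuous_map T euclidean (\<lambda>g. conj_by (U g) X $$ (i,j)))"

definition symmetric_state :: "('g, 'b) monoid_scheme \<Rightarrow> ('g \<Rightarrow> complex mat) \<Rightarrow> complex mat \<Rightarrow> bool" where
  "symmetric_state G U \<sigma> \<longleftrightarrow> (\<forall>g \<in> carrier G. conj_by (U g) \<sigma> = \<sigma>)"

definition covariant :: "('g, 'b) monoid_scheme \<Rightarrow> nat \<Rightarrow> ('g \<Rightarrow> complex mat) \<Rightarrow> ('g \<Rightarrow> complex mat)
     \<Rightarrow> (complex mat \<Rightarrow> complex mat) \<Rightarrow> bool" where
  "covariant G d UR US E \<longleftrightarrow> (\<forall>g \<in> carrier G. \<forall>X \<in> carrier_mat d d.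
      E (conj_by (kron (UR g) (US g)) X) = conj_by (kron (UR g) (US g)) (E X))"

end

theory Submission
  imports Defs "Jordan_Normal_Form.Determinant"
begin

text \<open>
  Composing \<open>E\<close> with \<open>\<sigma> \<mapsto> \<sigma> \<otimes> \<rho>\<^sub>S\<close> gives a covariant channel from \<open>R\<close> to \<open>RS\<close> with Kraus
  operators that split into operators \<open>A\<^sub>m\<^sub>k\<close> on \<open>R\<close>, where \<open>k\<close> indexes a basis of \<open>S\<close>. The channel
  \<open>F = \<Sum> A\<^sub>m\<^sub>k \<cdot> A\<^sub>m\<^sub>k\<^sup>*\<close> on \<open>R\<close> fixes every state \<open>\<rho>\<^sub>g\<close> of the orbit of \<open>\<rho>\<^sub>R\<close>, while the matrix elements
  of the output on \<open>S\<close> are sums of the numbers \<open>tr (\<rho>\<^sub>g A\<^sub>m\<^sub>l\<^sup>* A\<^sub>m\<^sub>k)\<close>. On the joint support of the orbit the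
  fixed points of the dual map \<open>L\<close> of \<open>F\<close> are exactly the matrices commuting with all Kraus
  operators and their adjoints. Hence the ergodic mean \<open>C\<close> of \<open>Z = A\<^sub>m\<^sub>l\<^sup>* A\<^sub>m\<^sub>k\<close> under \<open>L\<close> lies in the
  centre of the fixed-point algebra, and \<open>tr (\<rho>\<^sub>g Z) = tr (\<rho>\<^sub>g C)\<close>. By covariance the group acts on
  that centre, so the conjugates of \<open>C\<close> commute with each other; a continuous commuting orbit of a
  Hermitian matrix is locally constant, hence constant when the group is connected. Thus
  \<open>tr (\<rho>\<^sub>g Z)\<close> does not depend on \<open>g\<close>, and by covariance the output on \<open>S\<close> is symmetric.
\<close>

section \<open>Finitely supported matrices\<close>

text \<open>Heuristically, a system that comes back undisturbed can only have leaked classical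
  information: the label of a block in the decomposition of the fixed-point algebra. In finite
  dimension there are finitely many labels, and a connected group cannot permute them nontrivially;
  a disconnected one can.

  The obstacle is that fixed points of a unital completely positive map need not form an algebra
  unless there are enough invariant states, and a single state may have small support. The whole
  orbit is therefore used: covariance makes each of its members invariant, and its joint support is
  preserved by the group as well as by the Kraus operators.

  The ergodic mean is central because fixed points commute with the Kraus operators and their
  adjoints, hence with \<open>Z\<close>, which is built from them, and with every iterate of
  \<open>Z\<close>. Commuting Hermitian conjugates are simultaneously diagonal with one common
  finite spectrum, so they cannot move continuously; the Cayley transform makes this an algebraic
  statement about powers of unitaries, without diagonalising anything.\<close>

text \<open>Matrices of all sizes live in one non-unital ring, so that the algebra below needs no carrier
  conditions; size is recorded by the predicate \<open>fits\<close> and units by the idempotents \<open>idm n\<close>.\<close>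

typedef fmat = "{f :: nat \<Rightarrow> nat \<Rightarrow> complex. \<exists>n. \<forall>i j. f i j \<noteq> 0 \<longrightarrow> i < n \<and> j < n}"
  morphisms ent Abs_fmat
  by (rule exI[of _ "\<lambda>i j. 0"]) auto

definition fits :: "nat \<Rightarrow> fmat \<Rightarrow> bool" where
  "fits n A \<longleftrightarrow> (\<forall>i j. ent A i j \<noteq> 0 \<longrightarrow> i < n \<and> j < n)"

lemma ex_fits: "\<exists>n. fits n A"
  using ent[of A] by (auto simp: fits_def)

lemma fits_mono: "fits n A \<Longrightarrow> n \<le> m \<Longrightarrow> fits m A"
  unfolding fits_def by (meson order_less_le_trans)

lemma ex_fits2: "\<exists>n. fits n A \<and> fits n B"
  by (meson ex_fits fits_mono max.cobounded1 max.cobounded2)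

lemma ex_fits3: "\<exists>n. fits n A \<and> fits n B \<and> fits n C"
  by (meson ex_fits2 ex_fits fits_mono max.cobounded1 max.cobounded2)

lemma fmat_eqI: "(\<And>i j. ent A i j = ent B i j) \<Longrightarrow> A = B"
  by (metis ent_inject ext)

lemma fits_out: "fits n A \<Longrightarrow> \<not> (i < n \<and> j < n) \<Longrightarrow> ent A i j = 0"
  unfolding fits_def by blast

lemma fmat_eqI_fits:
  assumes "fits n A" "fits n B" "\<And>i j. i < n \<Longrightarrow> j < n \<Longrightarrow> ent A i j = ent B i j"
  shows "A = B"
  by (rule fmat_eqI) (metis assms fits_out)

lemma ent_Abs: "(\<And>i j. f i j \<noteq> 0 \<Longrightarrow> i < n \<and> j < n) \<Longrightarrow> ent (Abs_fmat f) = f"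
  by (rule Abs_fmat_inverse) blast

instantiation fmat :: ring
begin

definition zero_fmat :: fmat where "0 = Abs_fmat (\<lambda>i j. 0)"
definition plus_fmat :: "fmat \<Rightarrow> fmat \<Rightarrow> fmat" where
  "A + B = Abs_fmat (\<lambda>i j. ent A i j + ent B i j)"
definition uminus_fmat :: "fmat \<Rightarrow> fmat" where
  "- A = Abs_fmat (\<lambda>i j. - ent A i j)"
definition minus_fmat :: "fmat \<Rightarrow> fmat \<Rightarrow> fmat" where
  "A - B = Abs_fmat (\<lambda>i j. ent A i j - ent B i j)"
text \<open>Summing over the support of row \<open>i\<close> makes the product independent of any
  size bound; \<open>ent_mult\<close> recovers the usual sum over \<open>k<n\<close>.\<close>

definition times_fmat :: "fmat \<Rightarrow> fmat \<Rightarrow> fmat" where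
  "A * B = Abs_fmat (\<lambda>i j. \<Sum>k | ent A i k \<noteq> 0. ent A i k * ent B k j)"

lemma ent_zero: "ent 0 i j = 0"
  unfolding zero_fmat_def by (subst ent_Abs[where n=0]) auto

lemma ent_add: "ent (A + B) i j = ent A i j + ent B i j"
proof -
  obtain n where "fits n A" "fits n B" using ex_fits2 by blast
  then show ?thesis unfolding plus_fmat_def fits_def
    by (subst ent_Abs[where n=n]) (metis add.right_neutral, rule refl)
qed

lemma ent_minus: "ent (- A) i j = - ent A i j"
proof -
  obtain n where "fits n A" using ex_fits by blast
  then show ?thesis unfolding uminus_fmat_def fits_def by (subst ent_Abs[where n=n]) auto
qed

lemma ent_diff: "ent (A - B) i j = ent A i j - ent B i j"
proof -
  obtain n where "fits n A" "fits n B" using ex_fits2 by blast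
  then show ?thesis unfolding minus_fmat_def fits_def
    by (subst ent_Abs[where n=n]) (metis diff_zero, rule refl)
qed

lemma ent_mult:
  assumes "fits n A \<or> fits n B"
  shows "ent (A * B) i j = (\<Sum>k<n. ent A i k * ent B k j)"
proof -
  obtain m where m: "fits m A" "fits m B" using ex_fits2 by blast
  have "ent (A * B) = (\<lambda>i j. \<Sum>k | ent A i k \<noteq> 0. ent A i k * ent B k j)"
    unfolding times_fmat_def
  proof (rule ent_Abs[where n=m])
    fix i j assume "(\<Sum>k | ent A i k \<noteq> 0. ent A i k * ent B k j) \<noteq> 0"
    then obtain k where "ent A i k * ent B k j \<noteq> 0" by (meson sum.neutral)
    then show "i < m \<and> j < m" using m unfolding fits_def by auto
  qed
  moreover have "(\<Sum>k | ent A i k \<noteq> 0. ent A i k * ent B k j) = (\<Sum>k<n. ent A i k * ent B k j)"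
  proof (rule sum.mono_neutral_cong)
    show "finite {k. ent A i k \<noteq> 0}"
      by (rule finite_subset[of _ "{..<m}"]) (use m in \<open>auto simp: fits_def\<close>)
  next
    fix k assume k: "k \<in> {k. ent A i k \<noteq> 0} - {..<n}"
    show "ent A i k * ent B k j = 0"
      using assms k unfolding fits_def by auto
  qed auto
  ultimately show ?thesis by simp
qed

instance
proof
  fix a b c :: fmat
  obtain n where n: "fits n a" "fits n b" "fits n c" using ex_fits3 by blast
  show "a * b * c = a * (b * c)"
  proof (rule fmat_eqI)
    fix i j
    have "ent (a * b * c) i j = (\<Sum>k<n. \<Sum>l<n. ent a i l * ent b l k * ent c k j)"
      using n by (simp add: ent_mult[where n=n] sum_distrib_right)
    also have "\<dots> = (\<Sum>l<n. \<Sum>k<n. ent a i l * ent b l k * ent c k j)" by (rule sum.swap)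
    also have "\<dots> = ent (a * (b * c)) i j"
      using n by (simp add: ent_mult[where n=n] sum_distrib_left mult.assoc)
    finally show "ent (a * b * c) i j = ent (a * (b * c)) i j" .
  qed
  show "(a + b) * c = a * c + b * c"
    using n by (intro fmat_eqI)
      (simp add: ent_mult[where n=n] ent_add sum.distrib distrib_right)
  show "a * (b + c) = a * b + a * c"
    using n by (intro fmat_eqI)
      (simp add: ent_mult[where n=n] ent_add sum.distrib distrib_left)
qed (auto intro!: fmat_eqI simp: ent_add ent_zero ent_minus ent_diff)

end

lemma ent_sum: "ent (sum f S) i j = (\<Sum>s\<in>S. ent (f s) i j)"
  by (induction S rule: infinite_finite_induct) (auto simp: ent_zero ent_add)

definition fm :: "nat \<Rightarrow> (nat \<Rightarrow> nat \<Rightarrow> complex) \<Rightarrow> fmat" where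
  "fm n f = Abs_fmat (\<lambda>i j. if i < n \<and> j < n then f i j else 0)"

lemma ent_fm: "ent (fm n f) i j = (if i < n \<and> j < n then f i j else 0)"
  unfolding fm_def by (subst ent_Abs[where n=n]) (auto split: if_splits)

lemma fits_fm [simp]: "fits n (fm n f)"
  by (auto simp: fits_def ent_fm split: if_splits)

definition idm :: "nat \<Rightarrow> fmat" where
  "idm n = fm n (\<lambda>i j. if i = j then 1 else 0)"

definition star :: "fmat \<Rightarrow> fmat" where
  "star A = Abs_fmat (\<lambda>i j. cnj (ent A j i))"

definition cs :: "complex \<Rightarrow> fmat \<Rightarrow> fmat" where
  "cs c A = Abs_fmat (\<lambda>i j. c * ent A i j)"

definition tr :: "fmat \<Rightarrow> complex" where
  "tr A = (\<Sum>k | ent A k k \<noteq> 0. ent A k k)"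

lemma ent_star: "ent (star A) i j = cnj (ent A j i)"
proof -
  obtain n where "fits n A" using ex_fits by blast
  then show ?thesis unfolding star_def fits_def by (subst ent_Abs[where n=n]) auto
qed

lemma ent_cs: "ent (cs c A) i j = c * ent A i j"
proof -
  obtain n where "fits n A" using ex_fits by blast
  then show ?thesis unfolding cs_def fits_def by (subst ent_Abs[where n=n]) auto
qed

lemma ent_idm: "ent (idm n) i j = (if i = j \<and> i < n then 1 else 0)"
  by (auto simp: idm_def ent_fm)

lemma tr_eq: "fits n A \<Longrightarrow> tr A = (\<Sum>k<n. ent A k k)"
  unfolding tr_def by (rule sum.mono_neutral_left) (auto simp: fits_def)

lemma fits_idm [simp]: "fits n (idm n)" by (simp add: idm_def)
lemma fits_zero [simp]: "fits n 0" by (simp add: fits_def ent_zero)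
lemma fits_star [simp]: "fits n (star A) \<longleftrightarrow> fits n A" by (auto simp: fits_def ent_star)
lemma fits_cs [simp]: "fits n A \<Longrightarrow> fits n (cs c A)" by (auto simp: fits_def ent_cs)
lemma fits_add [simp]: "fits n A \<Longrightarrow> fits n B \<Longrightarrow> fits n (A + B)"
  unfolding fits_def by (metis add.right_neutral ent_add)
lemma fits_diff [simp]: "fits n A \<Longrightarrow> fits n B \<Longrightarrow> fits n (A - B)"
  unfolding fits_def by (metis diff_0_right diff_self ent_diff)
lemma fits_mult [simp]: "fits n A \<Longrightarrow> fits n B \<Longrightarrow> fits n (A * B)"
  unfolding fits_def using ent_mult[of n A B, unfolded fits_def]
  by (metis (no_types, lifting) mult_eq_0_iff sum.neutral)
lemma fits_sum [simp]: "(\<And>s. s \<in> S \<Longrightarrow> fits n (f s)) \<Longrightarrow> fits n (sum f S)"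
  by (induction S rule: infinite_finite_induct) auto

lemma idm_mult_left [simp]: "fits n A \<Longrightarrow> idm n * A = A"
  by (rule fmat_eqI_fits[of n]) (auto simp: ent_mult[where n=n] ent_idm if_distrib[of "\<lambda>x. x * _"] cong: if_cong)

lemma idm_mult_right [simp]: "fits n A \<Longrightarrow> A * idm n = A"
  by (rule fmat_eqI_fits[of n]) (auto simp: ent_mult[where n=n] ent_idm if_distrib[of "\<lambda>x. _ * x"] cong: if_cong conj_cong)

lemma star_star [simp]: "star (star A) = A" by (rule fmat_eqI) (simp add: ent_star)
lemma star_zero [simp]: "star 0 = 0" by (rule fmat_eqI) (simp add: ent_star ent_zero)
lemma star_add [simp]: "star (A + B) = star A + star B" by (rule fmat_eqI) (simp add: ent_star ent_add)
lemma star_diff [simp]: "star (A - B) = star A - star B" by (rule fmat_eqI) (simp add: ent_star ent_diff)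
lemma star_cs [simp]: "star (cs c A) = cs (cnj c) (star A)" by (rule fmat_eqI) (simp add: ent_star ent_cs)
lemma star_idm [simp]: "star (idm n) = idm n" by (rule fmat_eqI) (auto simp: ent_star ent_idm)
lemma star_sum: "star (sum f S) = (\<Sum>s\<in>S. star (f s))"
  by (induction S rule: infinite_finite_induct) auto
lemma star_mult [simp]: "star (A * B) = star B * star A"
proof -
  obtain n where n: "fits n A" "fits n B" using ex_fits2 by blast
  show ?thesis
    by (rule fmat_eqI) (use n in \<open>simp add: ent_star ent_mult[where n=n] mult.commute\<close>)
qed

lemma cs_mult_left: "cs c A * B = cs c (A * B)"
proof -
  obtain n where n: "fits n A" "fits n B" using ex_fits2 by blast
  show ?thesis
    by (rule fmat_eqI) (use n in \<open>simp add: ent_cs ent_mult[where n=n] sum_distrib_left mult.assoc\<close>)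
qed

lemma cs_mult_right: "A * cs c B = cs c (A * B)"
proof -
  obtain n where n: "fits n A" "fits n B" using ex_fits2 by blast
  show ?thesis
    by (rule fmat_eqI) (use n in \<open>simp add: ent_cs ent_mult[where n=n] sum_distrib_left mult.left_commute\<close>)
qed

lemma cs_cs [simp]: "cs a (cs b A) = cs (a * b) A" by (rule fmat_eqI) (simp add: ent_cs)
lemma cs_one [simp]: "cs 1 A = A" by (rule fmat_eqI) (simp add: ent_cs)
lemma cs_zero [simp]: "cs c 0 = 0" by (rule fmat_eqI) (simp add: ent_cs ent_zero)
lemma cs_diff: "cs c (A - B) = cs c A - cs c B"
  by (rule fmat_eqI) (simp add: ent_cs ent_diff right_diff_distrib)
lemma cs_sum: "cs c (sum f S) = (\<Sum>s\<in>S. cs c (f s))"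
  by (rule fmat_eqI) (simp add: ent_cs ent_sum sum_distrib_left)

lemma tr_zero [simp]: "tr 0 = 0" by (simp add: tr_def ent_zero)
lemma tr_add: "tr (A + B) = tr A + tr B"
proof -
  obtain n where n: "fits n A" "fits n B" using ex_fits2 by blast
  then show ?thesis by (simp add: tr_eq[where n=n] ent_add sum.distrib)
qed
lemma tr_diff: "tr (A - B) = tr A - tr B"
  using tr_add[of "A - B" B] by simp
lemma tr_cs: "tr (cs c A) = c * tr A"
proof -
  obtain n where n: "fits n A" using ex_fits by blast
  then show ?thesis by (simp add: tr_eq[where n=n] ent_cs sum_distrib_left)
qed
lemma tr_sum: "tr (sum f S) = (\<Sum>s\<in>S. tr (f s))"
  by (induction S rule: infinite_finite_induct) (auto simp: tr_add)
lemma tr_commute: "tr (A * B) = tr (B * A)"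
proof -
  obtain n where n: "fits n A" "fits n B" using ex_fits2 by blast
  then have "tr (A * B) = (\<Sum>i<n. \<Sum>k<n. ent A i k * ent B k i)"
    by (simp add: tr_eq[where n=n] ent_mult[where n=n])
  also have "\<dots> = (\<Sum>k<n. \<Sum>i<n. ent A i k * ent B k i)" by (rule sum.swap)
  also have "\<dots> = tr (B * A)" using n by (simp add: tr_eq[where n=n] ent_mult[where n=n] mult.commute)
  finally show ?thesis .
qed

lemma tr_star_mult: "fits n A \<Longrightarrow> tr (star A * A) = (\<Sum>i<n. \<Sum>j<n. complex_of_real ((cmod (ent A j i))\<^sup>2))"
  by (simp add: tr_eq[where n=n] ent_mult[where n=n] ent_star mult.commute complex_norm_square[symmetric])

definition sq_norm :: "fmat \<Rightarrow> real" where
  "sq_norm A = Re (tr (star A * A))"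

lemma sq_norm_eq: "fits n A \<Longrightarrow> sq_norm A = (\<Sum>i<n. \<Sum>j<n. (cmod (ent A j i))\<^sup>2)"
  by (simp add: sq_norm_def tr_star_mult)

lemma sq_norm_nonneg: "0 \<le> sq_norm A"
proof -
  obtain n where n: "fits n A" using ex_fits by blast
  then show ?thesis by (simp add: sq_norm_eq sum_nonneg)
qed

lemma ent_le_sq_norm: "(cmod (ent A a b))\<^sup>2 \<le> sq_norm A"
proof -
  obtain n where n: "fits n A" using ex_fits by blast
  show ?thesis
  proof (cases "a < n \<and> b < n")
    case True
    have "(cmod (ent A a b))\<^sup>2 \<le> (\<Sum>j<n. (cmod (ent A j b))\<^sup>2)"
      by (rule member_le_sum[of a]) (use True in auto)
    also have "\<dots> \<le> (\<Sum>i<n. \<Sum>j<n. (cmod (ent A j i))\<^sup>2)"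
      by (rule member_le_sum[of b]) (use True in \<open>auto intro: sum_nonneg\<close>)
    finally show ?thesis using sq_norm_eq[OF n] by simp
  next
    case False
    then show ?thesis using n sq_norm_nonneg by (simp add: fits_out)
  qed
qed

lemma sq_norm_zeroD: "sq_norm A = 0 \<Longrightarrow> A = 0"
  by (rule fmat_eqI) (use ent_le_sq_norm[of A] in \<open>auto simp: ent_zero\<close>)

lemma tr_star_mult_real: "tr (star A * A) = complex_of_real (sq_norm A)"
proof -
  obtain n where n: "fits n A" using ex_fits by blast
  then show ?thesis by (simp add: sq_norm_eq tr_star_mult)
qed

text \<open>Each summand is a squared Hilbert-Schmidt norm. This is how operator equations are
  extracted from trace identities below.\<close>

lemma sum_star_mult_zero:
  assumes "finite J" "(\<Sum>j\<in>J. tr (star (D j) * D j)) = 0" "j \<in> J"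
  shows "D j = 0"
proof -
  have "complex_of_real (\<Sum>j\<in>J. sq_norm (D j)) = 0"
    using assms(2) by (simp add: tr_star_mult_real)
  then have "(\<Sum>j\<in>J. sq_norm (D j)) = 0" using of_real_eq_0_iff by blast
  then have "sq_norm (D j) = 0"
    using assms sum_nonneg_eq_0_iff[of J "\<lambda>j. sq_norm (D j)"] sq_norm_nonneg by blast
  then show ?thesis by (rule sq_norm_zeroD)
qed

text \<open>The test matrix \<open>star Y\<close> already yields the squared norm of
  \<open>Y\<close>. Trace identities, where cyclicity is available, thus become matrix
  identities.\<close>

lemma tr_nondegenerate:
  assumes "fits n Y" "\<And>S. fits n S \<Longrightarrow> tr (S * Y) = 0"
  shows "Y = 0"
  using assms(2)[of "star Y"] assms(1) sum_star_mult_zero[of "{()}" "\<lambda>_. Y"] by simp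

section \<open>Transfer between carrier matrices and finitely supported ones\<close>

definition of_mat :: "nat \<Rightarrow> complex mat \<Rightarrow> fmat" where
  "of_mat n M = fm n (\<lambda>i j. M $$ (i,j))"

lemma ent_of_mat: "ent (of_mat n M) i j = (if i < n \<and> j < n then M $$ (i,j) else 0)"
  by (simp add: of_mat_def ent_fm)

lemma fits_of_mat [simp]: "fits n (of_mat n M)"
  by (simp add: of_mat_def)

lemma of_mat_mult:
  "A \<in> carrier_mat n n \<Longrightarrow> B \<in> carrier_mat n n \<Longrightarrow> of_mat n (A * B) = of_mat n A * of_mat n B"
  by (rule fmat_eqI_fits[of n]) (auto simp: ent_mult[where n=n] ent_of_mat scalar_prod_def lessThan_atLeast0)

lemma of_mat_one: "of_mat n (1\<^sub>m n) = idm n"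
  by (rule fmat_eqI_fits[of n]) (auto simp: ent_of_mat ent_idm)

lemma of_mat_dagger: "A \<in> carrier_mat n n \<Longrightarrow> of_mat n (dagger A) = star (of_mat n A)"
  by (rule fmat_eqI_fits[of n]) (auto simp: ent_of_mat ent_star dagger_def)

lemma of_mat_smult: "A \<in> carrier_mat n n \<Longrightarrow> of_mat n (c \<cdot>\<^sub>m A) = cs c (of_mat n A)"
  by (rule fmat_eqI_fits[of n]) (auto simp: ent_of_mat ent_cs)

text \<open>A kernel vector, repeated in every column of \<open>V\<close>, would violate
  cancellation, so the determinant is nonzero.\<close>

lemma left_cancellable_imp_invertible:
  assumes X: "fits n X" and inj: "\<And>V. fits n V \<Longrightarrow> X * V = 0 \<Longrightarrow> V = 0"
  obtains R where "fits n R" "R * X = idm n" "X * R = idm n"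
proof -
  define M where "M = mat n n (\<lambda>(i,j). ent X i j)"
  have M: "M \<in> carrier_mat n n" by (simp add: M_def)
  have oM: "of_mat n M = X"
    by (rule fmat_eqI_fits[of n]) (auto simp: ent_of_mat M_def X)
  have "det M \<noteq> 0"
  proof
    assume "det M = 0"
    then obtain v where v: "v \<in> carrier_vec n" "v \<noteq> 0\<^sub>v n" "M *\<^sub>v v = 0\<^sub>v n"
      using det_0_iff_vec_prod_zero_field[OF M] by blast
    define V where "V = fm n (\<lambda>i j. v $ i)"
    have "X * V = 0"
    proof (rule fmat_eqI_fits[of n])
      fix i j assume ij: "i < n" "j < n"
      have "ent (X * V) i j = (M *\<^sub>v v) $ i"
        using ij v(1) X by (auto simp: ent_mult[where n=n] V_def ent_fm M_def scalar_prod_def lessThan_atLeast0)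
      then show "ent (X * V) i j = ent 0 i j" using v(3) ij by (simp add: ent_zero)
    qed (auto simp: X V_def)
    then have V0: "V = 0" using inj[of V] by (simp add: V_def)
    have "v = 0\<^sub>v n"
    proof (rule eq_vecI)
      fix i assume "i < dim_vec (0\<^sub>v n :: complex vec)"
      then show "v $ i = 0\<^sub>v n $ i"
        using arg_cong[OF V0, of "\<lambda>A. ent A i i"] by (simp add: V_def ent_fm ent_zero)
    qed (use v in auto)
    with v(2) show False by simp
  qed
  from det_non_zero_imp_unit[OF M this, of "()"]
  obtain B where B: "B \<in> carrier_mat n n" "B * M = 1\<^sub>m n" "M * B = 1\<^sub>m n"
    unfolding Units_def ring_mat_def by auto
  show thesis
  proof (rule that[of "of_mat n B"])
    show "of_mat n B * X = idm n" using of_mat_mult[OF B(1) M] B(2) by (simp add: oM of_mat_one)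
    show "X * of_mat n B = idm n" using of_mat_mult[OF M B(1)] B(3) by (simp add: oM of_mat_one)
  qed simp
qed

section \<open>Commuting orbits under conjugation by unitaries\<close>

definition unitary :: "nat \<Rightarrow> fmat \<Rightarrow> bool" where
  "unitary n U \<longleftrightarrow> fits n U \<and> U * star U = idm n \<and> star U * U = idm n"

definition cj :: "fmat \<Rightarrow> fmat \<Rightarrow> fmat" where
  "cj U X = U * X * star U"

lemma unitaryD:
  assumes "unitary n U"
  shows "fits n U" "U * star U = idm n" "star U * U = idm n"
    "fits n Z \<Longrightarrow> U * (star U * Z) = Z" "fits n Z \<Longrightarrow> star U * (U * Z) = Z"
  using assms unfolding unitary_def by (auto simp flip: mult.assoc)

lemma unitary_star: "unitary n U \<Longrightarrow> unitary n (star U)"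
  by (simp add: unitary_def)

lemma unitary_mult:
  assumes "unitary n U" "unitary n V" shows "unitary n (U * V)"
  using unitaryD[OF assms(1)] unitaryD[OF assms(2)] unfolding unitary_def by (simp add: mult.assoc)

lemma fits_cj [simp]: "unitary n U \<Longrightarrow> fits n X \<Longrightarrow> fits n (cj U X)"
  by (simp add: cj_def unitary_def)

lemma cj_add: "cj U (X + Y) = cj U X + cj U Y" by (simp add: cj_def algebra_simps)
lemma cj_diff: "cj U (X - Y) = cj U X - cj U Y" by (simp add: cj_def algebra_simps)
lemma cj_cs: "cj U (cs c X) = cs c (cj U X)" by (simp add: cj_def cs_mult_left cs_mult_right)
lemma cj_sum: "cj U (sum f S) = (\<Sum>s\<in>S. cj U (f s))"
  by (simp add: cj_def sum_distrib_left sum_distrib_right)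
lemma cj_cj: "cj U (cj V X) = cj (U * V) X" by (simp add: cj_def mult.assoc)
lemma cj_idm: "unitary n U \<Longrightarrow> cj U (idm n) = idm n"
  by (simp add: cj_def unitary_def)
lemma cj_mult: "unitary n U \<Longrightarrow> fits n X \<Longrightarrow> fits n Y \<Longrightarrow> cj U (X * Y) = cj U X * cj U Y"
  by (simp add: cj_def mult.assoc unitaryD)
lemma cj_star_cj: "unitary n U \<Longrightarrow> fits n X \<Longrightarrow> cj (star U) (cj U X) = X"
  by (simp add: cj_def mult.assoc unitaryD)
lemma cj_cj_star: "unitary n U \<Longrightarrow> fits n X \<Longrightarrow> cj U (cj (star U) X) = X"
  using cj_star_cj[OF unitary_star, of n U X] by simp

lemma unitary_cj: "unitary n U \<Longrightarrow> unitary n X \<Longrightarrow> unitary n (cj U X)"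
  unfolding cj_def by (intro unitary_mult unitary_star)

section \<open>The entrywise l1 norm and iterated squaring\<close>

definition sn :: "fmat \<Rightarrow> real" where
  "sn A = (\<Sum>(i,j) | ent A i j \<noteq> 0. cmod (ent A i j))"

lemma sn_eq:
  assumes "fits n A" shows "sn A = (\<Sum>i<n. \<Sum>j<n. cmod (ent A i j))"
proof -
  have "sn A = (\<Sum>(i,j)\<in>{..<n}\<times>{..<n}. cmod (ent A i j))"
    unfolding sn_def by (rule sum.mono_neutral_left) (use assms in \<open>auto simp: fits_def\<close>)
  then show ?thesis by (simp add: sum.cartesian_product)
qed

lemma sn_nonneg: "0 \<le> sn A" unfolding sn_def by (auto intro: sum_nonneg)

lemma sn_zeroD: "sn A = 0 \<Longrightarrow> A = 0"
proof -
  obtain n where n: "fits n A" using ex_fits by blast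
  assume "sn A = 0"
  then have "\<And>i j. i < n \<Longrightarrow> j < n \<Longrightarrow> ent A i j = 0"
    using sn_eq[OF n] by (auto simp: sum_nonneg_eq_0_iff sum_nonneg)
  then show ?thesis by (intro fmat_eqI_fits[OF n, of 0]) (auto simp: ent_zero)
qed

lemma sn_add: "sn (A + B) \<le> sn A + sn B"
proof -
  obtain n where n: "fits n A" "fits n B" using ex_fits2 by blast
  then show ?thesis
    by (simp add: sn_eq[of n] ent_add flip: sum.distrib) (intro sum_mono norm_triangle_ineq)
qed

lemma sn_cs: "sn (cs c A) = cmod c * sn A"
proof -
  obtain n where n: "fits n A" using ex_fits by blast
  then show ?thesis by (simp add: sn_eq[of n] ent_cs norm_mult sum_distrib_left)
qed

lemma sn_sum: "sn (sum f S) \<le> (\<Sum>s\<in>S. sn (f s))"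
proof (induction S rule: infinite_finite_induct)
  case (insert x F)
  then show ?case using sn_add[of "f x" "sum f F"] by simp
qed (auto simp: sn_def ent_zero)

lemma sn_mult: "sn (A * B) \<le> sn A * sn B"
proof -
  obtain n where n: "fits n A" "fits n B" using ex_fits2 by blast
  have row: "(\<Sum>j<n. cmod (ent B k j)) \<le> sn B" if "k < n" for k
    unfolding sn_eq[OF n(2)] by (rule member_le_sum[of k]) (use that in \<open>auto intro: sum_nonneg\<close>)
  have "sn (A * B) \<le> (\<Sum>i<n. \<Sum>j<n. \<Sum>k<n. cmod (ent A i k) * cmod (ent B k j))"
    using n by (simp add: sn_eq[of n] ent_mult[where n=n])
      (intro sum_mono order_trans[OF norm_sum], simp add: norm_mult)
  also have "\<dots> = (\<Sum>i<n. \<Sum>k<n. cmod (ent A i k) * (\<Sum>j<n. cmod (ent B k j)))"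
    by (subst sum.swap) (simp add: sum_distrib_left)
  also have "\<dots> \<le> (\<Sum>i<n. \<Sum>k<n. cmod (ent A i k) * sn B)"
    by (intro sum_mono mult_left_mono row) auto
  also have "\<dots> = sn A * sn B" by (simp add: sn_eq[OF n(1)] sum_distrib_right)
  finally show ?thesis .
qed

text \<open>The power with exponent \<open>2 ^ k\<close>. These exponents suffice for the growth
  argument and require no unit in the ring.\<close>

primrec dbl :: "fmat \<Rightarrow> nat \<Rightarrow> fmat" where
  "dbl u 0 = u"
| "dbl u (Suc k) = dbl u k * dbl u k"

text \<open>A matrix whose iterated squares all stay close to the identity is the identity: with
  \<open>D = w - 1\<close> one has \<open>w\<^sup>2 - 1 = 2 D + D\<^sup>2\<close>, so the distance to \<open>1\<close> grows geometrically.\<close>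

lemma no_small_squarings:
  assumes w: "fits n w" and e: "e < 1" and small: "\<And>k. sn (dbl w k - idm n) \<le> e"
  shows "w = idm n"
proof -
  have fits: "fits n (dbl w k)" for k by (induction k) (auto simp: w)
  have step: "(2 - e) * sn (dbl w k - idm n) \<le> sn (dbl w (Suc k) - idm n)" for k
  proof -
    define D where "D = dbl w k - idm n"
    have "dbl w (Suc k) - idm n = cs 2 D + D * D"
      using fits[of k] by (intro fmat_eqI) (simp add: D_def algebra_simps ent_add ent_diff ent_cs)
    then have "cs 2 D = (dbl w (Suc k) - idm n) + cs (-1) (D * D)"
      by (intro fmat_eqI) (simp add: ent_add ent_diff ent_cs)
    then have "2 * sn D \<le> sn (dbl w (Suc k) - idm n) + sn (D * D)"
      using sn_add[of "dbl w (Suc k) - idm n" "cs (-1) (D * D)"] sn_cs[of 2 D] by (simp add: sn_cs)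
    moreover have "sn (D * D) \<le> e * sn D"
      using sn_mult[of D D] mult_right_mono[OF small[of k] sn_nonneg[of D]] by (simp add: D_def)
    ultimately show ?thesis by (simp add: D_def algebra_simps)
  qed
  have grow: "(2 - e) ^ k * sn (w - idm n) \<le> sn (dbl w k - idm n)" for k
  proof (induction k)
    case (Suc k)
    have "(2 - e) ^ Suc k * sn (w - idm n) \<le> (2 - e) * sn (dbl w k - idm n)"
      using mult_left_mono[OF Suc, of "2 - e"] e by (simp add: mult.assoc)
    then show ?case using step[of k] by simp
  qed simp
  have "sn (w - idm n) = 0"
  proof (rule ccontr)
    assume "sn (w - idm n) \<noteq> 0"
    then have pos: "sn (w - idm n) > 0" using sn_nonneg[of "w - idm n"] by linarith
    obtain k where "1 / sn (w - idm n) < (2 - e) ^ k"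
      using real_arch_pow[of "2 - e" "1 / sn (w - idm n)"] e by auto
    then have "1 < (2 - e) ^ k * sn (w - idm n)" using pos by (simp add: field_simps)
    then show False using grow[of k] small[of k] e by linarith
  qed
  then show ?thesis using sn_zeroD by fastforce
qed

lemma unitary_ent_le_1:
  assumes "unitary n U" shows "cmod (ent U i j) \<le> 1"
proof (cases "i < n \<and> j < n")
  case True
  have "complex_of_real (\<Sum>k<n. (cmod (ent U i k))\<^sup>2) = ent (U * star U) i i"
    using unitaryD(1)[OF assms]
    by (simp add: ent_mult[where n=n] ent_star complex_norm_square[symmetric] del: of_real_power)
  also have "\<dots> = 1" using unitaryD[OF assms] True by (simp add: ent_idm)
  finally have "(\<Sum>k<n. (cmod (ent U i k))\<^sup>2) = 1" using of_real_eq_1_iff by blast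
  moreover have "(cmod (ent U i j))\<^sup>2 \<le> (\<Sum>k<n. (cmod (ent U i k))\<^sup>2)"
    by (rule member_le_sum[of j]) (use True in auto)
  ultimately show ?thesis by (simp add: power_le_one_iff abs_square_le_1)
next
  case False
  then show ?thesis using unitaryD(1)[OF assms] by (simp add: fits_out)
qed

lemma unitary_sn: "unitary n U \<Longrightarrow> sn U \<le> real n * real n"
proof -
  assume U: "unitary n U"
  have "sn U \<le> (\<Sum>i<n. \<Sum>j<n. 1)"
    unfolding sn_eq[OF unitaryD(1)[OF U]] by (intro sum_mono unitary_ent_le_1[OF U])
  then show ?thesis by simp
qed

definition eij :: "nat \<Rightarrow> nat \<Rightarrow> nat \<Rightarrow> fmat" where
  "eij n a b = fm n (\<lambda>i j. if i = a \<and> j = b then 1 else 0)"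

lemma fits_eij [simp]: "fits n (eij n a b)" by (simp add: eij_def)

text \<open>Reduces estimates that must hold for all matrices at once to the finitely many matrix
  units.\<close>

lemma fmat_decomp:
  assumes "fits n Y" shows "Y = (\<Sum>a<n. \<Sum>b<n. cs (ent Y a b) (eij n a b))"
proof (rule fmat_eqI_fits[of n])
  fix i j assume ij: "i < n" "j < n"
  have "ent (\<Sum>a<n. \<Sum>b<n. cs (ent Y a b) (eij n a b)) i j
      = (\<Sum>a<n. \<Sum>b<n. if i = a then (if j = b then ent Y a b else 0) else 0)"
    unfolding ent_sum by (intro sum.cong refl) (use ij in \<open>simp add: ent_cs eij_def ent_fm\<close>)
  also have "\<dots> = (\<Sum>a<n. if i = a then (\<Sum>b<n. if j = b then ent Y a b else 0) else 0)"
    by (intro sum.cong refl) auto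
  also have "\<dots> = ent Y i j" using ij by (simp add: sum.delta)
  finally show "ent Y i j = ent (\<Sum>a<n. \<Sum>b<n. cs (ent Y a b) (eij n a b)) i j" by simp
qed (use assms in auto)

text \<open>\<open>R\<close> is the resolvent, and \<open>2 R - 1 = (1 + \<i> C) R\<close> is the
  Cayley transform. Its unitarity amounts to \<open>R + star R\<close> being twice the product of
  \<open>R\<close> and \<open>star R\<close> in either order.\<close>

lemma cayley:
  assumes C: "fits n C" "star C = C"
  obtains R where "fits n R" "R * (idm n - cs \<i> C) = idm n" "(idm n - cs \<i> C) * R = idm n"
    "unitary n (cs 2 R - idm n)"
proof -
  define N where "N = idm n - cs \<i> C"
  have N: "fits n N" by (simp add: N_def C)
  obtain R where R: "fits n R" "R * N = idm n" "N * R = idm n"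
  proof (rule left_cancellable_imp_invertible[OF N])
    fix V assume V: "fits n V" "N * V = 0"
    then have e: "V = cs \<i> (C * V)" by (simp add: N_def left_diff_distrib cs_mult_left)
    \<comment> \<open>The left side is Hermitian and the right side anti-Hermitian, so both
      vanish.\<close>
    have 1: "star V * V = cs \<i> (star V * C * V)"
      by (subst (2) e) (simp add: cs_mult_right mult.assoc)
    have "star (star V * V) = cs (-\<i>) (star V * C * V)"
      by (subst 1) (simp add: C mult.assoc)
    then have "star V * V = cs (-\<i>) (star V * C * V)" by simp
    with 1 have "cs 1 (star V * V) + cs 1 (star V * V) = 0"
      by (intro fmat_eqI) (metis (no_types, lifting) add.right_inverse cs_one ent_add ent_cs ent_zero
          mult_minus_left)
    then have "tr (star V * V) + tr (star V * V) = 0" using tr_add tr_zero by (metis cs_one)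
    then show "V = 0" using sum_star_mult_zero[of "{()}" "\<lambda>_. V"] by simp
  qed blast
  have sN: "star N = idm n + cs \<i> C"
    by (intro fmat_eqI) (simp add: N_def C ent_add ent_diff ent_cs)
  have comm: "star N * N = N * star N" unfolding sN by (simp add: N_def C algebra_simps)
  \<comment> \<open>Sandwiching this identity between \<open>R\<close> and \<open>star R\<close>, in
    either order, gives the two equations that unitarity needs.\<close>
  have NN: "N + star N = cs 2 (idm n)"
    unfolding sN by (intro fmat_eqI) (simp add: N_def ent_add ent_diff ent_cs)
  have sR: "star R * star N = idm n" "star N * star R = idm n"
    using arg_cong[OF R(3), of star] arg_cong[OF R(2), of star] by simp_all
  have 1: "R + star R = cs 2 (R * star R)"
  proof -
    have "R * (N + star N) * star R = R * N * star R + R * (star N * star R)"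
      by (simp add: algebra_simps)
    also have "\<dots> = star R + R" using R sR by simp
    finally show ?thesis using R by (simp add: NN cs_mult_left cs_mult_right add.commute)
  qed
  have 2: "R + star R = cs 2 (star R * R)"
  proof -
    have "star R * (N + star N) * R = star R * (N * R) + star R * star N * R"
      by (simp add: algebra_simps)
    also have "\<dots> = star R + R" using R sR by simp
    finally show ?thesis using R by (simp add: NN cs_mult_left cs_mult_right add.commute)
  qed
  have "unitary n (cs 2 R - idm n)"
    unfolding unitary_def
  proof (intro conjI)
    have "(cs 2 R - idm n) * star (cs 2 R - idm n) = cs 2 (cs 2 (R * star R) - (R + star R)) + idm n"
      using R by (intro fmat_eqI) (simp add: algebra_simps cs_mult_left cs_mult_right ent_add ent_diff ent_cs)
    then show "(cs 2 R - idm n) * star (cs 2 R - idm n) = idm n" using 1 by simp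
    have "star (cs 2 R - idm n) * (cs 2 R - idm n) = cs 2 (cs 2 (star R * R) - (R + star R)) + idm n"
      using R by (intro fmat_eqI) (simp add: algebra_simps cs_mult_left cs_mult_right ent_add ent_diff ent_cs)
    then show "star (cs 2 R - idm n) * (cs 2 R - idm n) = idm n" using 2 by simp
  qed (use R in simp)
  with R that show thesis unfolding N_def by blast
qed

text \<open>\<open>f\<close> is continuous into a discrete space, so its fibres are clopen.\<close>

lemma connected_locally_constant:
  assumes conn: "connected_space T"
    and loc: "\<And>h. h \<in> topspace T \<Longrightarrow> \<exists>V. openin T V \<and> h \<in> V \<and> (\<forall>g\<in>V. f g = f h)"
    and gh: "g \<in> topspace T" "h \<in> topspace T"
  shows "f g = f h"
proof -
  define S where "S = {x \<in> topspace T. f x = f h}"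
  have op: "openin T {x \<in> topspace T. P (f x)}" for P
  proof (subst openin_subopen, rule ballI)
    fix x assume x: "x \<in> {x \<in> topspace T. P (f x)}"
    then have "x \<in> topspace T" by simp
    from loc[OF this] obtain V where V: "openin T V" "x \<in> V" "\<And>g. g \<in> V \<Longrightarrow> f g = f x" by metis
    have "V \<subseteq> {x \<in> topspace T. P (f x)}"
    proof
      fix y assume y: "y \<in> V"
      then have "P (f y)" using V(3)[OF y] x by simp
      then show "y \<in> {x \<in> topspace T. P (f x)}" using openin_subset[OF V(1)] y by blast
    qed
    with V(1,2) show "\<exists>V. openin T V \<and> x \<in> V \<and> V \<subseteq> {x \<in> topspace T. P (f x)}" by blast
  qed
  have "openin T S" unfolding S_def by (rule op)
  moreover have "openin T (topspace T - S)"
    using op[of "\<lambda>y. y \<noteq> f h"] by (simp add: S_def set_diff_eq cong: conj_cong)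
  ultimately have "S = {} \<or> S = topspace T"
    using conn unfolding connected_space_clopen_in closedin_def by (auto simp: S_def)
  then show ?thesis using gh by (auto simp: S_def)
qed

text \<open>The orbit of \<open>C\<close> is locally constant. Write \<open>\<alpha>\<^sub>g\<close> for conjugation by \<open>U g\<close> and let \<open>u\<close> be the
  Cayley transform of \<open>C\<close>. Commutativity gives \<open>w\<^sup>k = \<alpha>\<^sub>g (u\<^sup>k) \<alpha>\<^sub>h (u\<^sup>k)\<^sup>*\<close> for \<open>w = \<alpha>\<^sub>g (u) \<alpha>\<^sub>h (u)\<^sup>*\<close>,
  and since the \<open>u\<^sup>k\<close> are unitary, all these powers are close to \<open>1\<close> once \<open>g\<close> is close to \<open>h\<close>.\<close>

lemma commuting_orbit_constant:
  fixes U :: "'g \<Rightarrow> fmat"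
  assumes unit: "\<And>g. g \<in> topspace T \<Longrightarrow> unitary n (U g)"
    and cont: "\<And>X i j. fits n X \<Longrightarrow> continuous_map T euclidean (\<lambda>g. ent (cj (U g) X) i j)"
    and conn: "connected_space T"
    and C: "fits n C" "star C = C"
    and comm: "\<And>g h. g \<in> topspace T \<Longrightarrow> h \<in> topspace T \<Longrightarrow>
      cj (U g) C * cj (U h) C = cj (U h) C * cj (U g) C"
    and gh: "g \<in> topspace T" "h \<in> topspace T"
  shows "cj (U g) C = cj (U h) C"
proof (rule connected_locally_constant[OF conn _ gh])
  fix h assume h: "h \<in> topspace T"
  \<comment> \<open>A finite sum of entry distances on the matrix units: it is continuous in
    \<open>g\<close>, vanishes at \<open>g = h\<close>, and controls all unitary arguments
    simultaneously because their entries have modulus at most 1.\<close>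
  define \<delta> where "\<delta> g = (\<Sum>a<n. \<Sum>b<n. \<Sum>i<n. \<Sum>j<n.
    cmod (ent (cj (U g) (eij n a b)) i j - ent (cj (U h) (eij n a b)) i j))" for g
  have \<delta>_sn: "\<delta> g = (\<Sum>a<n. \<Sum>b<n. sn (cj (U g) (eij n a b) - cj (U h) (eij n a b)))"
    if "g \<in> topspace T" for g
    unfolding \<delta>_def by (intro sum.cong refl) (simp add: sn_eq[of n] unit h that ent_diff)
  have \<delta>: "sn (cj (U g) Y - cj (U h) Y) \<le> \<delta> g" if g: "g \<in> topspace T" and Y: "unitary n Y" for g Y
  proof -
    have "cj (U g) Y - cj (U h) Y
      = (\<Sum>a<n. \<Sum>b<n. cs (ent Y a b) (cj (U g) (eij n a b) - cj (U h) (eij n a b)))"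
      by (subst (1 2) fmat_decomp[OF unitaryD(1)[OF Y]])
        (simp add: cj_sum cj_cs cs_diff sum_subtractf)
    also have "sn \<dots> \<le> (\<Sum>a<n. \<Sum>b<n. sn (cs (ent Y a b) (cj (U g) (eij n a b) - cj (U h) (eij n a b))))"
      by (intro order_trans[OF sn_sum] sum_mono order_refl)
    also have "\<dots> \<le> \<delta> g"
      unfolding \<delta>_sn[OF g] sn_cs
      by (intro sum_mono mult_left_le_one_le sn_nonneg norm_ge_zero unitary_ent_le_1[OF Y])
    finally show ?thesis .
  qed
  obtain R where R: "fits n R" "R * (idm n - cs \<i> C) = idm n" "(idm n - cs \<i> C) * R = idm n"
    and u: "unitary n (cs 2 R - idm n)"
    using cayley[OF C] by blast
  define u where "u = cs 2 R - idm n"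
  define N where "N g = idm n - cs \<i> (cj (U g) C)" for g
  define Q where "Q g = cj (U g) R" for g
  have Nf: "fits n (N g)" if "g \<in> topspace T" for g using unit[OF that] C by (simp add: N_def)
  have Qf: "fits n (Q g)" if "g \<in> topspace T" for g using unit[OF that] R by (simp add: Q_def)
  have QN: "Q g * N g = idm n" "N g * Q g = idm n" if "g \<in> topspace T" for g
  proof -
    note U = unit[OF that]
    have "N g = cj (U g) (idm n - cs \<i> C)"
      by (simp add: N_def cj_diff cj_idm[OF U] cj_cs)
    then show "Q g * N g = idm n" "N g * Q g = idm n"
      using R C by (simp_all add: Q_def cj_idm[OF U] flip: cj_mult[OF U])
  qed
  have Qcomm: "Q g * Q h = Q h * Q g" if g: "g \<in> topspace T" for g
  proof -
    have NN: "N g * N h = N h * N g"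
      using comm[OF g h] unit[OF g] unit[OF h] C
      by (simp add: N_def algebra_simps cs_mult_left cs_mult_right cs_diff)
    \<comment> \<open>The inserted factor is the identity, as \<open>Q h * Q g\<close> inverts
      \<open>N g * N h\<close>. Exchanging \<open>N g\<close> and \<open>N h\<close> then lets the
      inverses cancel the other way round.\<close>
    have "Q g * Q h = Q g * Q h * ((N g * N h) * (Q h * Q g))"
      using g h QN[OF g] QN[OF h] Nf Qf
      by (metis fits_mult idm_mult_left idm_mult_right mult.assoc)
    also have "\<dots> = Q g * (Q h * N h) * N g * (Q h * Q g)" unfolding NN by (simp add: mult.assoc)
    also have "\<dots> = Q h * Q g"
      using g h QN[OF g] QN[OF h] Nf Qf by (simp add: mult.assoc)
    finally show ?thesis .
  qed
  \<comment> \<open>The factor \<open>real n * real n\<close> bounds \<open>sn\<close> of a unitary;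
    it is the price of multiplying by the adjoint of \<open>cj (U h) y\<close> in the estimate of
    the iterated squares.\<close>
  have main: "cj (U g) C = cj (U h) C" if g: "g \<in> topspace T" and small: "\<delta> g * (real n * real n) < 1" for g
  proof -
    define a where "a = cj (U g) u"
    define b where "b = cj (U h) u"
    have ab: "unitary n a" "unitary n b"
      unfolding a_def b_def u_def using u unit g h by (auto intro: unitary_cj)
    have aQ: "a = cs 2 (Q g) - idm n" "b = cs 2 (Q h) - idm n"
      by (simp_all add: a_def b_def u_def Q_def cj_diff cj_cs cj_idm unit g h)
    have "a * b = b * a"
      unfolding aQ using Qcomm[OF g] Qf[OF g] Qf[OF h]
      by (simp add: algebra_simps cs_mult_left cs_mult_right cs_diff)
    then have "star b * (a * (b * star b)) = (star b * b) * a * star b" by (metis mult.assoc)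
    then have asb: "star b * a = a * star b"
      using unitaryD(1)[OF ab(1)] unitaryD(2,3)[OF ab(2)] by simp
    have du: "unitary n (dbl u k)" for k by (induction k) (use u in \<open>auto simp: u_def intro: unitary_mult\<close>)
    have da: "dbl a k = cj (U g) (dbl u k)" for k
      by (induction k) (simp_all add: a_def cj_mult[OF unit[OF g]] unitaryD(1)[OF du])
    have db: "dbl b k = cj (U h) (dbl u k)" for k
      by (induction k) (simp_all add: b_def cj_mult[OF unit[OF h]] unitaryD(1)[OF du])
    have dab: "dbl (a * star b) k = dbl a k * star (dbl b k) \<and> star (dbl b k) * dbl a k = dbl a k * star (dbl b k)" for k
    proof (induction k)
      case 0 then show ?case using asb by simp
    next
      case (Suc k)
      define x y where "x = dbl a k" and "y = star (dbl b k)"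
      have yx: "y * x = x * y" using Suc by (simp add: x_def y_def)
      have "y * (x * z) = x * (y * z)" for z using yx by (metis mult.assoc)
      then have "x * y * (x * y) = (x * x) * (y * y)" "(y * y) * (x * x) = (x * x) * (y * y)"
        using yx by (simp_all add: mult.assoc)
      then show ?case using Suc by (simp add: x_def y_def)
    qed
    have "a * star b = idm n"
    proof (rule no_small_squarings[OF _ small])
      show "fits n (a * star b)" using ab by (simp add: unitary_def)
      fix k
      define y where "y = dbl u k"
      have y: "unitary n (cj (U h) y)" using du unit[OF h] unitary_cj by (simp add: y_def)
      have "dbl (a * star b) k - idm n = (cj (U g) y - cj (U h) y) * star (cj (U h) y)"
        using dab[of k] y unfolding da db y_def[symmetric] by (simp add: left_diff_distrib unitary_def)
      then have "sn (dbl (a * star b) k - idm n) \<le> sn (cj (U g) y - cj (U h) y) * sn (star (cj (U h) y))"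
        using sn_mult by simp
      also have "\<dots> \<le> \<delta> g * (real n * real n)"
        by (intro mult_mono \<delta>[OF g] unitary_sn unitary_star y sn_nonneg order_trans[OF sn_nonneg \<delta>[OF g]])
          (use du in \<open>auto simp: y_def\<close>)
      finally show "sn (dbl (a * star b) k - idm n) \<le> \<delta> g * (real n * real n)" .
    qed
    then have "a * star b * b = idm n * b" by simp
    then have "a = b" using unitaryD[OF ab(1)] unitaryD[OF ab(2)] by (simp add: mult.assoc)
    \<comment> \<open>The Cayley transform is injective: it determines the resolvent, and the
      resolvent determines the matrix.\<close>
    then have "cs (1/2) (cs 2 (Q g)) = cs (1/2) (cs 2 (Q h))" unfolding aQ by simp
    then have "Q g = Q h" by simp
    then have "N g = N h"
      using QN[OF g] QN[OF h] Nf[OF g] Nf[OF h] by (metis idm_mult_left idm_mult_right mult.assoc)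
    then have "cs (-\<i>) (cs \<i> (cj (U g) C)) = cs (-\<i>) (cs \<i> (cj (U h) C))" by (simp add: N_def)
    then show ?thesis by simp
  qed
  have "continuous_map T euclideanreal (\<lambda>g. \<delta> g * (real n * real n))"
    unfolding \<delta>_def
    by (intro continuous_map_real_mult continuous_map_sum continuous_map_norm continuous_map_diff cont)
      (auto simp: fits_eij)
  then have "openin T {g \<in> topspace T. \<delta> g * (real n * real n) \<in> {..<1}}"
    by (rule openin_continuous_map_preimage) auto
  moreover have "\<delta> h = 0" by (simp add: \<delta>_def)
  then have "h \<in> {g \<in> topspace T. \<delta> g * (real n * real n) \<in> {..<1}}" using h by simp
  moreover have "\<forall>g \<in> {g \<in> topspace T. \<delta> g * (real n * real n) \<in> {..<1}}. cj (U g) C = cj (U h) C"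
    by (rule ballI, rule main) auto
  ultimately show "\<exists>V. openin T V \<and> h \<in> V \<and> (\<forall>g\<in>V. cj (U g) C = cj (U h) C)"
    by (intro exI conjI)
qed

text \<open>Multiplying the hypothesis on the right by \<open>star Y\<close> gives a vanishing
  squared norm. Orbit states can thus be replaced by their factors when testing
  annihilation.\<close>

lemma mult_star_cancel:
  assumes "Y * (c * star c) = 0" shows "Y * c = 0"
proof -
  have "star (star (Y * c)) * star (Y * c) = Y * (c * star c) * star Y" by (simp add: mult.assoc)
  then have "star (Y * c) = 0"
    using assms sum_star_mult_zero[of "{()}" "\<lambda>_. star (Y * c)"] by simp
  then show ?thesis by (metis star_star star_zero)
qed

section \<open>Matrix units, projections onto spans of columns, and compactness\<close>

lemma eij_mult: "b < n \<Longrightarrow> eij n a b * eij n b c = eij n a c"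
  by (rule fmat_eqI_fits[of n])
    (auto simp: ent_mult[where n=n] eij_def ent_fm if_distrib[of "\<lambda>x. x * _"] cong: if_cong)

lemma star_eij: "star (eij n a b) = eij n b a"
  by (rule fmat_eqI_fits[of n]) (auto simp: ent_star eij_def ent_fm)

lemma tr_mult_eij:
  assumes "fits n X" "a < n" "b < n" shows "tr (X * eij n b a) = ent X a b"
proof -
  have "tr (X * eij n b a) = (\<Sum>i<n. \<Sum>k<n. if i = a then (if k = b then ent X a b else 0) else 0)"
    using assms by (auto simp: tr_eq[where n=n] ent_mult[where n=n] eij_def ent_fm intro!: sum.cong)
  also have "\<dots> = (\<Sum>i<n. if i = a then (\<Sum>k<n. if k = b then ent X a b else 0) else 0)"
    by (intro sum.cong refl) auto
  finally show ?thesis using assms by simp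
qed

lemma sq_norm_eij: "a < n \<Longrightarrow> b < n \<Longrightarrow> sq_norm (eij n a b) = 1"
  using tr_mult_eij[of n "idm n" b b] by (simp add: sq_norm_def star_eij eij_mult ent_idm)

lemma tr_idm: "tr (idm n) = of_nat n"
  by (simp add: tr_eq[where n=n] ent_idm)

text \<open>\<open>P\<close> has maximal rank among the projections whose range lies in the span of the columns of the
  members of \<open>S\<close>.\<close>

lemma support_projection:
  obtains P where "fits n P" "star P = P" "P * P = P"
    "\<And>B. B \<in> S \<Longrightarrow> fits n B \<Longrightarrow> P * B = B"
    "\<And>Y. (\<And>B. B \<in> S \<Longrightarrow> fits n B \<Longrightarrow> Y * B = 0) \<Longrightarrow> Y * P = 0"
proof -
  \<comment> \<open>The trace of a projection is its rank, and the annihilator clause expresses that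
    the range lies in the span without mentioning subspaces.\<close>
  define good where "good k P \<longleftrightarrow> fits n P \<and> star P = P \<and> P * P = P \<and> tr P = of_nat k \<and>
    (\<forall>Y. (\<forall>B\<in>S. fits n B \<longrightarrow> Y * B = 0) \<longrightarrow> Y * P = 0)" for k P
  have le: "k \<le> n" if "good k P" for k P
  proof -
    have "star (idm n - P) * (idm n - P) = idm n - P"
      using that by (simp add: good_def algebra_simps)
    then have "0 \<le> Re (tr (idm n - P))"
      using sq_norm_nonneg[of "idm n - P"] by (simp add: sq_norm_def)
    then show ?thesis using that by (simp add: good_def tr_diff tr_idm)
  qed
  have step: "\<exists>P'. good (Suc k) P'" if P: "good k P" and B: "B \<in> S" "fits n B" "P * B \<noteq> B" for k P B
  proof -
    define D where "D = B - P * B"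
    have Pf: "fits n P" "star P = P" "P * P = P" using P by (auto simp: good_def)
    have D: "fits n D" "D \<noteq> 0" using B Pf by (auto simp: D_def)
    have PD: "P * D = 0" using Pf by (simp add: D_def right_diff_distrib flip: mult.assoc)
    obtain a j where aj: "ent D a j \<noteq> 0" using D(2) by (metis fmat_eqI ent_zero)
    then have ajn: "a < n" "j < n" using D(1) by (auto simp: fits_def)
    \<comment> \<open>One nonzero column of the defect \<open>D\<close>, moved to column 0. Then
      \<open>star w * w\<close> is a multiple of a single matrix unit, so \<open>w * star w\<close>
      rescales to a rank-one projection orthogonal to \<open>P\<close>.\<close>
    define w where "w = D * eij n j 0"
    define c where "c = complex_of_real (sq_norm w)"
    have n0: "0 < n" using ajn by simp
    have wf: "fits n w" using D by (simp add: w_def)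
    have Pw: "P * w = 0" using PD by (simp add: w_def flip: mult.assoc)
    have wP: "star w * P = 0" using arg_cong[OF Pw, of star] Pf by simp
    have "w \<noteq> 0"
    proof
      assume "w = 0"
      then have "tr (w * eij n 0 a) = 0" by simp
      moreover have "w * eij n 0 a = D * eij n j a" using n0 by (simp add: w_def mult.assoc eij_mult)
      ultimately show False using tr_mult_eij[OF D(1) ajn] aj by simp
    qed
    then have c: "c \<noteq> 0" using sq_norm_zeroD by (auto simp: c_def)
    have w0: "w * eij n 0 0 = w" using n0 by (simp add: w_def mult.assoc eij_mult)
    have ww: "star w * w = cs c (eij n 0 0)"
    proof (rule fmat_eqI_fits[of n])
      fix i k assume ik: "i < n" "k < n"
      have e: "eij n 0 0 * star w = star w" using arg_cong[OF w0, of star] by (simp add: star_eij)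
      have "eij n 0 0 * (star w * w) * eij n 0 0 = (eij n 0 0 * star w) * (w * eij n 0 0)"
        by (simp only: mult.assoc)
      then have eq: "eij n 0 0 * (star w * w) * eij n 0 0 = star w * w" by (simp only: e w0)
      have "ent (eij n 0 0 * G * eij n 0 0) i k = (if i = 0 \<and> k = 0 then ent G 0 0 else 0)" for G
        by (auto simp: ent_mult[where n=n] eij_def ent_fm ik n0 if_distrib[of "\<lambda>x. x * _"]
            if_distrib[of "\<lambda>x. _ * x"] cong: if_cong)
      from this[of "star w * w"]
      have "ent (star w * w) i k = (if i = 0 \<and> k = 0 then ent (star w * w) 0 0 else 0)"
        by (simp only: eq)
      moreover have "ent (star w * w) 0 0 = c"
      proof -
        have "tr (star w * w) = tr (star w * w * eij n 0 0)" using w0 by (simp add: mult.assoc)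
        also have "\<dots> = ent (star w * w) 0 0" by (rule tr_mult_eij) (use wf n0 in auto)
        finally show ?thesis by (simp add: c_def tr_star_mult_real)
      qed
      ultimately show "ent (star w * w) i k = ent (cs c (eij n 0 0)) i k"
        using ik n0 by (simp add: ent_cs eij_def ent_fm)
    qed (use wf in auto)
    define P' where "P' = P + cs (1 / c) (w * star w)"
    have "good (Suc k) P'"
      unfolding good_def
    proof (intro conjI allI impI)
      show "fits n P'" using Pf wf by (simp add: P'_def)
      show "star P' = P'" using Pf by (simp add: P'_def c_def)
      have www: "w * (star w * (w * star w)) = cs c (w * star w)"
      proof -
        have "w * (star w * (w * star w)) = w * (star w * w) * star w" by (simp add: mult.assoc)
        also have "\<dots> = cs c (w * star w)" using w0 by (simp add: ww cs_mult_left cs_mult_right)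
        finally show ?thesis .
      qed
      have "P * (w * star w) = 0" using Pw by (simp flip: mult.assoc)
      moreover have "w * star w * P = 0" using wP by (simp add: mult.assoc)
      ultimately show "P' * P' = P'"
        using Pf www c by (simp add: P'_def algebra_simps cs_mult_left cs_mult_right)
      have "tr (w * star w) = c" by (simp add: tr_commute[of w] tr_star_mult_real c_def)
      then show "tr P' = of_nat (Suc k)" using P c by (simp add: P'_def tr_add tr_cs good_def)
      fix Y assume Y: "\<forall>B\<in>S. fits n B \<longrightarrow> Y * B = 0"
      then have "Y * B = 0" "Y * P = 0" using P B by (auto simp: good_def)
      then have "Y * w = 0" by (simp add: w_def D_def right_diff_distrib flip: mult.assoc)
      then have "Y * (w * star w) = 0" by (simp flip: mult.assoc)
      then show "Y * P' = 0" using \<open>Y * P = 0\<close> by (simp add: P'_def distrib_left cs_mult_right)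
    qed
    then show ?thesis by blast
  qed
  have g0: "good 0 0" by (simp add: good_def)
  define k where "k = (GREATEST k. \<exists>P. good k P)"
  have "\<exists>P. good k P"
    unfolding k_def by (rule GreatestI_nat[of _ 0 n]) (use g0 le in auto)
  then obtain P where P: "good k P" by blast
  have max: "\<not> good (Suc k) P'" for P'
    using Greatest_le_nat[of "\<lambda>k. \<exists>P. good k P" "Suc k" n] le unfolding k_def by fastforce
  show thesis
  proof (rule that[of P])
    show "P * B = B" if "B \<in> S" "fits n B" for B using step[OF P that] max by blast
  qed (use P in \<open>auto simp: good_def\<close>)
qed

text \<open>Bolzano-Weierstrass, refining the subsequence one coordinate at a time.\<close>

lemma bounded_family_convergent_subsequence:
  fixes f :: "nat \<Rightarrow> 'i \<Rightarrow> complex"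
  assumes "finite I" "\<And>i k. i \<in> I \<Longrightarrow> cmod (f k i) \<le> c"
  shows "\<exists>r l. strict_mono (r :: nat \<Rightarrow> nat) \<and> (\<forall>i\<in>I. (\<lambda>k. f (r k) i) \<longlonglongrightarrow> l i)"
  using assms
proof (induction I rule: finite_induct)
  case empty
  then show ?case by (intro exI[of _ id]) (auto simp: strict_mono_def)
next
  case (insert x F)
  then obtain r l where r: "strict_mono r" "\<forall>i\<in>F. (\<lambda>k. f (r k) i) \<longlonglongrightarrow> l i" by auto
  have "bounded (range (\<lambda>k. f (r k) x))"
    using insert.prems by (auto simp: bounded_iff)
  then obtain m s where s: "strict_mono s" "((\<lambda>k. f (r k) x) \<circ> s) \<longlonglongrightarrow> m"
    using bounded_imp_convergent_subsequence by blast
  have "\<forall>i\<in>insert x F. (\<lambda>k. f ((r \<circ> s) k) i) \<longlonglongrightarrow> (l(x := m)) i"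
  proof
    fix i assume i: "i \<in> insert x F"
    show "(\<lambda>k. f ((r \<circ> s) k) i) \<longlonglongrightarrow> (l(x := m)) i"
    proof (cases "i = x")
      case True then show ?thesis using s by (simp add: o_def)
    next
      case False
      then have "(\<lambda>k. f (r k) i) \<longlonglongrightarrow> l i" using i r by auto
      from LIMSEQ_subseq_LIMSEQ[OF this s(1)] show ?thesis using False by (simp add: o_def)
    qed
  qed
  then show ?case using strict_mono_o[OF r(1) s(1)] by blast
qed

section \<open>Unital completely positive maps\<close>

definition cv :: "(nat \<Rightarrow> fmat) \<Rightarrow> fmat \<Rightarrow> bool" where
  "cv X C \<longleftrightarrow> (\<forall>a b. (\<lambda>k. ent (X k) a b) \<longlonglongrightarrow> ent C a b)"

lemma cv_unique: "cv X C \<Longrightarrow> cv X D \<Longrightarrow> C = D"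
  unfolding cv_def by (intro fmat_eqI) (meson LIMSEQ_unique)

lemma cv_diff: "cv X C \<Longrightarrow> cv Y D \<Longrightarrow> cv (\<lambda>k. X k - Y k) (C - D)"
  unfolding cv_def by (auto simp: ent_diff intro: tendsto_diff)

lemma cv_sum: "(\<And>j. j \<in> J \<Longrightarrow> cv (\<lambda>k. X k j) (C j)) \<Longrightarrow> cv (\<lambda>k. \<Sum>j\<in>J. X k j) (sum C J)"
  unfolding cv_def by (auto simp: ent_sum intro: tendsto_sum)

lemma cv_mult_left:
  assumes "cv X C" shows "cv (\<lambda>k. A * X k) (A * C)"
proof -
  obtain n where n: "fits n A" using ex_fits by blast
  show ?thesis using assms n unfolding cv_def
    by (auto simp: ent_mult[where n=n] intro!: tendsto_intros)
qed

lemma cv_mult_right: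
  assumes "cv X C" shows "cv (\<lambda>k. X k * A) (C * A)"
proof -
  obtain n where n: "fits n A" using ex_fits by blast
  show ?thesis using assms n unfolding cv_def
    by (auto simp: ent_mult[where n=n] intro!: tendsto_intros)
qed

lemma cv_tr:
  assumes "cv X C" "\<And>k. fits n (X k)" "fits n C" shows "(\<lambda>k. tr (X k)) \<longlonglongrightarrow> tr C"
  using assms unfolding cv_def by (auto simp: tr_eq[where n=n] intro!: tendsto_intros)

locale unital_kraus =
  fixes n :: nat and J :: "'j set" and B :: "'j \<Rightarrow> fmat"
  assumes finJ: "finite J" and fitsB: "j \<in> J \<Longrightarrow> fits n (B j)"
    and unital: "(\<Sum>j\<in>J. star (B j) * B j) = idm n"
begin

text \<open>\<open>L\<close> is the Heisenberg picture, unital on observables; \<open>F\<close> is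
  the Schroedinger picture on states, dual to it under the trace pairing.\<close>

definition L :: "fmat \<Rightarrow> fmat" where "L X = (\<Sum>j\<in>J. star (B j) * X * B j)"
definition F :: "fmat \<Rightarrow> fmat" where "F X = (\<Sum>j\<in>J. B j * X * star (B j))"

lemma fits_L [simp]: "fits n X \<Longrightarrow> fits n (L X)" unfolding L_def by (auto simp: fitsB)
lemma fits_F [simp]: "fits n X \<Longrightarrow> fits n (F X)" unfolding F_def by (auto simp: fitsB)
lemma L_star: "L (star X) = star (L X)" by (simp add: L_def star_sum mult.assoc)
lemma L_add: "L (X + Y) = L X + L Y" by (simp add: L_def algebra_simps sum.distrib)
lemma L_diff: "L (X - Y) = L X - L Y" by (simp add: L_def algebra_simps sum_subtractf)
lemma L_cs: "L (cs c X) = cs c (L X)" by (simp add: L_def cs_mult_left cs_mult_right cs_sum)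
lemma L_sum: "L (sum f S) = (\<Sum>s\<in>S. L (f s))"
  unfolding L_def by (subst sum.swap) (simp add: sum_distrib_left sum_distrib_right)

lemma duality: "tr (F S * X) = tr (S * L X)"
proof -
  have "tr (B j * S * star (B j) * X) = tr (S * (star (B j) * X * B j))" for j
    by (metis mult.assoc tr_commute)
  then show ?thesis by (simp add: F_def L_def sum_distrib_left sum_distrib_right tr_sum)
qed

text \<open>Covariance is inherited from the channel by \<open>F\<close> and passes to
  \<open>L\<close> through the trace pairing. The pairing exchanges \<open>V\<close> with its
  adjoint, so both directions are proved together.\<close>

lemma L_cj:
  assumes V: "unitary n V" and cov: "\<And>S. fits n S \<Longrightarrow> F (cj V S) = cj V (F S)" and X: "fits n X"
  shows "L (cj V X) = cj V (L X)" and "L (cj (star V) X) = cj (star V) (L X)"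
proof -
  have trcj: "tr (S * cj W Y) = tr (cj (star W) S * Y)" for S W Y
    by (simp add: cj_def) (metis mult.assoc tr_commute)
  have cov': "F (cj (star V) S) = cj (star V) (F S)" if "fits n S" for S
    using cov[of "cj (star V) S"] that V unitary_star[OF V] by (simp add: cj_cj_star cj_star_cj)
  have gen: "L (cj W Y) = cj W (L Y)"
    if W: "unitary n W" and c: "\<And>S. fits n S \<Longrightarrow> F (cj (star W) S) = cj (star W) (F S)" and Y: "fits n Y"
    for W Y
  proof -
    have "L (cj W Y) - cj W (L Y) = 0"
    proof (rule tr_nondegenerate)
      fix S assume S: "fits n S"
      have "tr (S * L (cj W Y)) = tr (cj (star W) (F S) * Y)" by (simp add: trcj flip: duality)
      also have "\<dots> = tr (S * cj W (L Y))" by (simp add: trcj duality flip: c[OF S])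
      finally show "tr (S * (L (cj W Y) - cj W (L Y))) = 0" by (simp add: right_diff_distrib tr_diff)
    qed (use W Y in auto)
    then show ?thesis by simp
  qed
  show "L (cj V X) = cj V (L X)" by (rule gen[OF V cov' X])
  show "L (cj (star V) X) = cj (star V) (L X)"
    by (rule gen[OF unitary_star[OF V] _ X]) (simp add: cov)
qed

text \<open>For \<open>L X = X\<close> the sum of \<open>[X, B\<^sub>j]\<^sup>* [X, B\<^sub>j]\<close> telescopes to \<open>L (X\<^sup>* X) - X\<^sup>* X\<close>,
  which is annihilated by every state fixed under the dual map \<open>F\<close>.\<close>

lemma fixed_commutes_aux:
  assumes faithful: "\<forall>Y. fits n Y \<and> (\<forall>b\<in>R. Y * b = 0) \<longrightarrow> Y = 0"
    and R: "\<forall>b\<in>R. fits n b \<and> F (b * star b) = b * star b"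
    and X: "fits n X" "L X = X" and j: "j \<in> J"
  shows "X * B j = B j * X"
proof -
  define D where "D j = X * B j - B j * X" for j
  have LX: "L (star X) = star X" by (simp add: L_star X)
  have DD: "(\<Sum>j\<in>J. star (D j) * D j) = L (star X * X) - star X * X"
  proof -
    have "star (D j) * D j = star (B j) * (star X * X) * B j - (star (B j) * star X * B j) * X
       - star X * (star (B j) * X * B j) + star X * (star (B j) * B j) * X" for j
      by (simp add: D_def algebra_simps)
    then have "(\<Sum>j\<in>J. star (D j) * D j) = L (star X * X) - L (star X) * X - star X * L X
        + star X * (\<Sum>j\<in>J. star (B j) * B j) * X"
      by (simp add: L_def sum.distrib sum_subtractf sum_distrib_left sum_distrib_right)
    then show ?thesis using X by (simp add: unital LX mult.assoc)
  qed
  have "D j * b = 0" if b: "b \<in> R" for b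
  proof (rule sum_star_mult_zero[OF finJ _ j, of "\<lambda>j. D j * b"])
    have "tr (star (D j * b) * (D j * b)) = tr (b * star b * (star (D j) * D j))" for j
      by simp (metis mult.assoc tr_commute)
    then have "(\<Sum>j\<in>J. tr (star (D j * b) * (D j * b))) = tr (b * star b * (L (star X * X) - star X * X))"
      by (simp add: sum_distrib_left tr_sum flip: DD)
    also have "\<dots> = 0" using R b by (simp add: right_diff_distrib tr_diff flip: duality)
    finally show "(\<Sum>j\<in>J. tr (star (D j * b) * (D j * b))) = 0" .
  qed
  moreover have "fits n (D j)" unfolding D_def by (intro fits_diff fits_mult fitsB j X(1))
  ultimately have "D j = 0" using faithful by blast
  then show ?thesis by (simp add: D_def)
qed

lemma fixed_commutes:
  assumes "\<forall>Y. fits n Y \<and> (\<forall>b\<in>R. Y * b = 0) \<longrightarrow> Y = 0"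
    and "\<forall>b\<in>R. fits n b \<and> F (b * star b) = b * star b"
    and X: "fits n X" "L X = X" and j: "j \<in> J"
  shows "X * B j = B j * X" "X * star (B j) = star (B j) * X"
proof -
  show "X * B j = B j * X" by (rule fixed_commutes_aux[OF assms])
  have "star X * B j = B j * star X"
    by (rule fixed_commutes_aux[OF assms(1,2) _ _ j]) (simp_all add: X L_star)
  from arg_cong[OF this, of star] show "X * star (B j) = star (B j) * X" by simp
qed

text \<open>A stand-in for the operator norm: \<open>L\<close> preserves this bound with the same
  constant, so all iterates are bounded uniformly.\<close>

definition form_bounded :: "real \<Rightarrow> fmat \<Rightarrow> bool" where
  "form_bounded c X \<longleftrightarrow> (\<forall>V W. fits n V \<longrightarrow> fits n W \<longrightarrow>
    cmod (tr (star V * X * W)) \<le> c * (sq_norm V + sq_norm W))"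

lemma sum_sq_norm: "fits n V \<Longrightarrow> (\<Sum>j\<in>J. sq_norm (B j * V)) = sq_norm V"
proof -
  assume V: "fits n V"
  have "(\<Sum>j\<in>J. tr (star (B j * V) * (B j * V))) = tr (star V * (\<Sum>j\<in>J. star (B j) * B j) * V)"
    by (simp add: sum_distrib_left sum_distrib_right tr_sum mult.assoc)
  then have "(\<Sum>j\<in>J. tr (star (B j * V) * (B j * V))) = tr (star V * V)" using V by (simp add: unital)
  from arg_cong[OF this, of Re] show ?thesis by (simp add: sq_norm_def)
qed

text \<open>The Kraus operators are absorbed into \<open>V\<close> and \<open>W\<close>, whose
  squared norms add up to the original ones by unitality.\<close>

lemma form_bounded_L:
  assumes X: "form_bounded c X" shows "form_bounded c (L X)"
  unfolding form_bounded_def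
proof (intro allI impI)
  fix V W assume VW: "fits n V" "fits n W"
  have "tr (star V * L X * W) = (\<Sum>j\<in>J. tr (star (B j * V) * X * (B j * W)))"
    by (simp add: L_def sum_distrib_left sum_distrib_right tr_sum mult.assoc)
  also have "cmod \<dots> \<le> (\<Sum>j\<in>J. c * (sq_norm (B j * V) + sq_norm (B j * W)))"
    by (intro order_trans[OF norm_sum] sum_mono X[unfolded form_bounded_def, rule_format])
      (auto intro!: fits_mult fitsB VW)
  also have "\<dots> = c * (sq_norm V + sq_norm W)"
    using VW by (simp add: sum_sq_norm sum.distrib flip: sum_distrib_left)
  finally show "cmod (tr (star V * L X * W)) \<le> c * (sq_norm V + sq_norm W)" .
qed

text \<open>Matrix units in column 0 isolate one entry; the 2 is the sum of their squared
  norms.\<close>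

lemma form_bounded_ent:
  assumes "form_bounded c X" "fits n X" "a < n" "b < n"
  shows "cmod (ent X a b) \<le> c * 2"
proof -
  have "tr (star (eij n a 0) * X * eij n b 0) = tr (X * (eij n b 0 * eij n 0 a))"
    by (simp add: star_eij) (metis mult.assoc tr_commute)
  also have "\<dots> = ent X a b" using assms by (simp add: eij_mult tr_mult_eij)
  finally have "cmod (ent X a b) \<le> c * (sq_norm (eij n a 0) + sq_norm (eij n b 0))"
    using assms(1) unfolding form_bounded_def by (metis fits_eij)
  then show ?thesis using assms by (simp add: sq_norm_eij)
qed

lemma ex_form_bounded:
  assumes X: "fits n X" obtains c where "c \<ge> 0" "form_bounded c X"
proof
  \<comment> \<open>Each of the two test matrices contributes \<open>n * n\<close>, the cost of
    bounding \<open>sn\<close> by the Hilbert-Schmidt norm.\<close>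
  define c where "c = (real n * real n) * (real n * real n) * sn X"
  show c0: "c \<ge> 0" by (simp add: c_def sn_nonneg)
  have sn_le: "sn V \<le> real n * real n * sqrt (sq_norm V)" if "fits n V" for V
  proof -
    have "sn V \<le> (\<Sum>i<n. \<Sum>j<n. sqrt (sq_norm V))"
      unfolding sn_eq[OF that] by (intro sum_mono real_le_rsqrt ent_le_sq_norm)
    then show ?thesis by simp
  qed
  have tr_le: "cmod (tr A) \<le> sn A" if "fits n A" for A
  proof -
    have "cmod (tr A) \<le> (\<Sum>i<n. cmod (ent A i i))" unfolding tr_eq[OF that] by (rule norm_sum)
    also have "\<dots> \<le> sn A" unfolding sn_eq[OF that]
      by (intro sum_mono member_le_sum[of _ _ "\<lambda>j. cmod (ent A _ j)"]) auto
    finally show ?thesis .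
  qed
  have sn_star: "sn (star A) = sn A" if "fits n A" for A
    using that by (simp add: sn_eq[of n] ent_star) (rule sum.swap)
  show "form_bounded c X"
    unfolding form_bounded_def
  proof (intro allI impI)
    fix V W assume VW: "fits n V" "fits n W"
    define v w where "v = sqrt (sq_norm V)" and "w = sqrt (sq_norm W)"
    have vw: "0 \<le> v" "0 \<le> w" "v\<^sup>2 = sq_norm V" "w\<^sup>2 = sq_norm W"
      by (simp_all add: v_def w_def sq_norm_nonneg)
    have "cmod (tr (star V * X * W)) \<le> sn (star V * X * W)" by (intro tr_le) (use VW X in simp)
    also have "\<dots> \<le> sn V * sn X * sn W"
      using sn_mult[of "star V * X" W] mult_right_mono[OF sn_mult[of "star V" X] sn_nonneg[of W]]
      by (simp add: sn_star[OF VW(1)])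
    also have "\<dots> \<le> (real n * real n * v) * sn X * (real n * real n * w)"
      using sn_le[OF VW(1)] sn_le[OF VW(2)] vw
      by (intro mult_mono) (auto simp: v_def w_def sn_nonneg)
    also have "\<dots> = c * (v * w)" by (simp add: c_def)
    also have "\<dots> \<le> c * (v\<^sup>2 + w\<^sup>2)"
      using c0 sum_squares_bound[of v w] vw by (intro mult_left_mono) (auto intro: order_trans[of _ "2 * v * w"])
    finally show "cmod (tr (star V * X * W)) \<le> c * (sq_norm V + sq_norm W)" by (simp add: vw)
  qed
qed

text \<open>\<open>C\<close> is a limit point of the Cesaro means of the iterates of \<open>L\<close> at \<open>Z\<close>.\<close>

lemma ergodic_mean:
  assumes Z: "fits n Z"
  shows "\<exists>C. fits n C \<and> L C = C \<and>
    (\<forall>X. (\<forall>j\<in>J. X * B j = B j * X \<and> X * star (B j) = star (B j) * X) \<and> X * Z = Z * X \<longrightarrow> X * C = C * X) \<and>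
    (\<forall>\<rho>. fits n \<rho> \<and> F \<rho> = \<rho> \<longrightarrow> tr (\<rho> * C) = tr (\<rho> * Z))"
proof -
  define it where "it k = (L ^^ k) Z" for k
  define M where "M N = cs (1 / of_nat (Suc N)) (\<Sum>k<Suc N. it k)" for N
  have fit: "fits n (it k)" for k unfolding it_def by (induction k) (auto simp: Z)
  have fM: "fits n (M N)" for N unfolding M_def by (intro fits_cs fits_sum fit)
  obtain c where c: "c \<ge> 0" "form_bounded c Z" using ex_form_bounded[OF Z] by blast
  have "form_bounded c (it k)" for k
    unfolding it_def by (induction k) (auto simp: c form_bounded_L)
  then have bit: "cmod (ent (it k) a b) \<le> c * 2" for k a b
    using form_bounded_ent[OF _ fit, of c k a b] fits_out[OF fit, of a b k] c by (cases "a < n \<and> b < n") auto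
  have bM: "cmod (ent (M N) a b) \<le> c * 2" for N a b
  proof -
    have "cmod (\<Sum>k<Suc N. ent (it k) a b) \<le> (\<Sum>k<Suc N. c * 2)"
      by (intro order_trans[OF norm_sum] sum_mono bit)
    then show ?thesis
      unfolding M_def ent_cs ent_sum norm_mult by (simp add: norm_divide field_simps del: sum.lessThan_Suc of_nat_Suc)
  qed
  obtain r l where r: "strict_mono (r :: nat \<Rightarrow> nat)"
    and l: "\<forall>i\<in>{..<n} \<times> {..<n}. (\<lambda>k. ent (M (r k)) (fst i) (snd i)) \<longlonglongrightarrow> l i"
    using bounded_family_convergent_subsequence[of "{..<n} \<times> {..<n}" "\<lambda>N i. ent (M N) (fst i) (snd i)" "c * 2"] bM
    by auto
  define C where "C = fm n (\<lambda>a b. l (a, b))"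
  have fC: "fits n C" by (simp add: C_def)
  have cvM: "cv (\<lambda>k. M (r k)) C"
    unfolding cv_def
  proof (intro allI)
    fix a b
    show "(\<lambda>k. ent (M (r k)) a b) \<longlonglongrightarrow> ent C a b"
    proof (cases "a < n \<and> b < n")
      case True
      then show ?thesis using l by (force simp: C_def ent_fm)
    next
      case False
      then show ?thesis using fits_out[OF fM] fits_out[OF fC] by simp
    qed
  qed
  have "cv (\<lambda>k. L (M (r k))) (L C)"
    unfolding L_def by (intro cv_sum cv_mult_right cv_mult_left cvM)
  then have 1: "cv (\<lambda>k. L (M (r k)) - M (r k)) (L C - C)" by (intro cv_diff cvM)
  \<comment> \<open>The sums telescope, leaving two bounded terms divided by \<open>Suc N\<close>;
    hence any limit point of the means is fixed.\<close>
  have LM: "L (M N) - M N = cs (1 / of_nat (Suc N)) (it (Suc N) - Z)" for N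
  proof -
    have "(\<Sum>k<Suc N. it (Suc k)) - (\<Sum>k<Suc N. it k) = it (Suc N) - it 0"
      using sum_lessThan_telescope[of it "Suc N"] by (simp only: sum_subtractf)
    moreover have "L (M N) = cs (1 / of_nat (Suc N)) (\<Sum>k<Suc N. it (Suc k))"
      unfolding M_def L_cs L_sum by (simp only: it_def funpow.simps o_def)
    ultimately show ?thesis unfolding M_def by (simp only: flip: cs_diff) (simp add: it_def)
  qed
  have "cv (\<lambda>N. L (M N) - M N) 0"
    unfolding cv_def
  proof (intro allI)
    fix a b
    have "(\<lambda>N. inverse (real (Suc N)) * (c * 4)) \<longlonglongrightarrow> 0 * (c * 4)"
      by (intro tendsto_mult LIMSEQ_inverse_real_of_nat tendsto_const)
    then have lim: "(\<lambda>N. inverse (real (Suc N)) * (c * 4)) \<longlonglongrightarrow> 0" by simp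
    have "cmod (ent (L (M N) - M N) a b) \<le> inverse (real (Suc N)) * (c * 4)" for N
    proof -
      have "cmod (ent (it (Suc N) - Z) a b) \<le> cmod (ent (it (Suc N)) a b) + cmod (ent (it 0) a b)"
        by (simp only: ent_diff it_def funpow.simps id_apply norm_triangle_ineq4)
      also have "\<dots> \<le> c * 4" using bit[of "Suc N" a b] bit[of 0 a b] by linarith
      finally have "cmod (1 / of_nat (Suc N)) * cmod (ent (it (Suc N) - Z) a b) \<le> inverse (real (Suc N)) * (c * 4)"
        by (intro mult_mono) (auto simp: norm_divide divide_simps simp del: of_nat_Suc)
      then show ?thesis unfolding LM ent_cs norm_mult .
    qed
    then have "(\<lambda>N. ent (L (M N) - M N) a b) \<longlonglongrightarrow> 0"
      by (intro Lim_null_comparison[OF _ lim]) auto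
    then show "(\<lambda>N. ent (L (M N) - M N) a b) \<longlonglongrightarrow> ent 0 a b" by (simp add: ent_zero)
  qed
  then have 2: "cv (\<lambda>k. L (M (r k)) - M (r k)) 0"
    unfolding cv_def using LIMSEQ_subseq_LIMSEQ[OF _ r, unfolded o_def] by blast
  have LC: "L C = C" using cv_unique[OF 1 2] by simp
  show ?thesis
  proof (intro exI[of _ C] conjI allI impI fC LC)
    fix X assume "(\<forall>j\<in>J. X * B j = B j * X \<and> X * star (B j) = star (B j) * X) \<and> X * Z = Z * X"
    then have comm: "\<forall>j\<in>J. X * B j = B j * X \<and> X * star (B j) = star (B j) * X"
      and XZ: "X * Z = Z * X" by blast+
    have X: "X * B j = B j * X" "X * star (B j) = star (B j) * X" if "j \<in> J" for j
      using comm that by blast+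
    have XL: "X * L Y = L Y * X" if Y: "X * Y = Y * X" for Y
    proof -
      have "X * (star (B j) * Y * B j) = (star (B j) * Y * B j) * X" if "j \<in> J" for j
      proof -
        have "X * (star (B j) * Y * B j) = X * star (B j) * Y * B j" by (simp add: mult.assoc)
        also have "\<dots> = star (B j) * (X * Y) * B j" by (simp only: X(2)[OF that] mult.assoc)
        also have "\<dots> = star (B j) * Y * (X * B j)" by (simp only: Y mult.assoc)
        finally show ?thesis by (simp only: X(1)[OF that] mult.assoc)
      qed
      then show ?thesis unfolding L_def sum_distrib_left sum_distrib_right by (rule sum.cong[OF refl])
    qed
    have "X * it k = it k * X" for k
      by (induction k) (simp_all add: it_def XZ XL)
    then have "X * M N = M N * X" for N
      by (simp only: M_def cs_mult_left cs_mult_right sum_distrib_left sum_distrib_right)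
    moreover have "cv (\<lambda>k. X * M (r k)) (X * C)" "cv (\<lambda>k. M (r k) * X) (C * X)"
      by (intro cv_mult_left cv_mult_right cvM)+
    ultimately show "X * C = C * X" by (simp add: cv_unique)
  next
    fix \<rho> assume "fits n \<rho> \<and> F \<rho> = \<rho>"
    then have \<rho>: "fits n \<rho>" "F \<rho> = \<rho>" by blast+
    have "tr (\<rho> * it k) = tr (\<rho> * Z)" for k
    proof (induction k)
      case (Suc k)
      have "tr (\<rho> * it (Suc k)) = tr (\<rho> * L (it k))" by (simp add: it_def)
      also have "\<dots> = tr (\<rho> * it k)" by (simp add: \<rho> flip: duality)
      finally show ?case using Suc by simp
    qed (simp add: it_def)
    then have "tr (\<rho> * M N) = tr (\<rho> * Z)" for N
      by (simp add: M_def cs_mult_right tr_cs sum_distrib_left tr_sum del: sum.lessThan_Suc of_nat_Suc)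
    moreover have "(\<lambda>k. tr (\<rho> * M (r k))) \<longlonglongrightarrow> tr (\<rho> * C)"
      by (rule cv_tr[OF cv_mult_left[OF cvM], of n]) (auto simp: \<rho> fM fC)
    ultimately show "tr (\<rho> * C) = tr (\<rho> * Z)" by (simp add: LIMSEQ_const_iff)
  qed
qed

end

text \<open>The group enters only through the conjugations: \<open>comp\<close> and
  \<open>inv\<close> are stated for these, which makes phases invisible. The state is given by a
  factor \<open>b\<close>, so that the joint support of the orbit is spanned by the columns of all
  \<open>U g * b\<close>.\<close>

theorem information_leak_constant:
  fixes U :: "'g \<Rightarrow> fmat" and A :: "'j \<Rightarrow> fmat"
  assumes unit: "\<And>g. g \<in> topspace T \<Longrightarrow> unitary n (U g)"
    and cont: "\<And>X i j. fits n X \<Longrightarrow> continuous_map T euclidean (\<lambda>g. ent (cj (U g) X) i j)"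
    and conn: "connected_space T"
    and e: "e \<in> topspace T" "\<And>X. fits n X \<Longrightarrow> cj (U e) X = X"
    and comp: "\<And>g h. g \<in> topspace T \<Longrightarrow> h \<in> topspace T \<Longrightarrow>
      \<exists>k\<in>topspace T. \<forall>X. fits n X \<longrightarrow> cj (U g) (cj (U h) X) = cj (U k) X"
    and inv: "\<And>g h. g \<in> topspace T \<Longrightarrow> h \<in> topspace T \<Longrightarrow>
      \<exists>k\<in>topspace T. \<forall>X. fits n X \<longrightarrow> cj (star (U g)) (cj (U h) X) = cj (U k) X"
    and finJ: "finite J" and fitsA: "\<And>j. j \<in> J \<Longrightarrow> fits n (A j)"
    and unital: "(\<Sum>j\<in>J. star (A j) * A j) = idm n"
    and b: "fits n b"
    and fixed: "(\<Sum>j\<in>J. A j * (b * star b) * star (A j)) = b * star b"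
    and cov: "\<And>g X. g \<in> topspace T \<Longrightarrow> fits n X \<Longrightarrow>
      (\<Sum>j\<in>J. A j * cj (U g) X * star (A j)) = cj (U g) (\<Sum>j\<in>J. A j * X * star (A j))"
    and g: "g \<in> topspace T" and i: "i \<in> J" and j: "j \<in> J"
  shows "tr (cj (U g) (b * star b) * (star (A i) * A j)) = tr (b * star b * (star (A i) * A j))"
proof -
  define \<rho> where "\<rho> g = cj (U g) (b * star b)" for g
  define c where "c g = U g * b" for g
  have fU: "fits n (U g)" if "g \<in> topspace T" for g using unitaryD(1)[OF unit[OF that]] .
  have fc: "fits n (c g)" if "g \<in> topspace T" for g unfolding c_def by (intro fits_mult fU that b)
  have \<rho>c: "\<rho> g = c g * star (c g)" for g by (simp add: \<rho>_def c_def cj_def mult.assoc)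
  have f\<rho>: "fits n (\<rho> g)" if "g \<in> topspace T" for g
    unfolding \<rho>c using fc[OF that] by simp
  have fixed\<rho>: "(\<Sum>j\<in>J. A j * \<rho> g * star (A j)) = \<rho> g" if "g \<in> topspace T" for g
    unfolding \<rho>_def by (subst cov[OF that]) (simp_all add: b fixed)
  obtain P where P: "fits n P" "star P = P" "P * P = P"
    and Pc': "\<And>B. B \<in> c ` topspace T \<Longrightarrow> fits n B \<Longrightarrow> P * B = B"
    and Pnull': "\<And>Y. (\<And>B. B \<in> c ` topspace T \<Longrightarrow> fits n B \<Longrightarrow> Y * B = 0) \<Longrightarrow> Y * P = 0"
    by (rule support_projection[of n "c ` topspace T"]) (rule that; blast)
  have Pc: "P * c g = c g" if "g \<in> topspace T" for g
    using Pc'[of "c g"] fc[OF that] that by simp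
  have Pnull: "Y * P = 0" if "\<And>g. g \<in> topspace T \<Longrightarrow> Y * \<rho> g = 0" for Y
  proof (rule Pnull')
    fix B assume "B \<in> c ` topspace T"
    then obtain g where "g \<in> topspace T" "B = c g" by blast
    then show "Y * B = 0" using that[of g] mult_star_cancel[of Y "c g"] by (simp add: \<rho>c)
  qed
  define Q where "Q = idm n - P"
  have Q: "fits n Q" "star Q = Q" "Q * Q = Q" "Q * P = 0" "P * Q = 0" "P + Q = idm n"
    using P by (simp_all add: Q_def algebra_simps)
  have P\<rho>: "P * \<rho> g = \<rho> g" "\<rho> g * P = \<rho> g" if "g \<in> topspace T" for g
  proof -
    show 1: "P * \<rho> g = \<rho> g" using Pc[OF that] by (simp add: \<rho>c flip: mult.assoc)
    have "star (P * \<rho> g) = star (\<rho> g)" by (simp only: 1)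
    then show "\<rho> g * P = \<rho> g" by (simp add: P \<rho>c mult.assoc)
  qed
  have Q\<rho>: "Q * \<rho> g = 0" "\<rho> g * Q = 0" if "g \<in> topspace T" for g
    using P\<rho>[OF that] f\<rho>[OF that] by (simp_all add: Q_def algebra_simps)
  have UP: "U g * P = P * U g" if g: "g \<in> topspace T" for g
  proof -
    \<comment> \<open>A unitary whose conjugation sends orbit states to orbit states maps their
      joint support into itself. Using this for \<open>U g\<close> and for its adjoint gives
      commutation with \<open>P\<close>.\<close>
    have QWP: "Q * W * P = 0"
      if W: "unitary n W"
        and orbit: "\<And>h. h \<in> topspace T \<Longrightarrow> \<exists>k\<in>topspace T. cj W (\<rho> h) = \<rho> k" for W
    proof (rule Pnull)
      fix h assume h: "h \<in> topspace T"
      then obtain k where k: "k \<in> topspace T" "cj W (\<rho> h) = \<rho> k" using orbit by blast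
      have "W * \<rho> h = cj W (\<rho> h) * W" using unitaryD[OF W] f\<rho>[OF h] by (simp add: cj_def mult.assoc)
      then have "Q * W * \<rho> h = Q * \<rho> k * W" by (simp add: k mult.assoc)
      then show "Q * W * \<rho> h = 0" using Q\<rho>[OF k(1)] by simp
    qed
    have "Q * U g * P = 0"
    proof (rule QWP[OF unit[OF g]])
      fix h assume "h \<in> topspace T"
      from comp[OF g this] show "\<exists>k\<in>topspace T. cj (U g) (\<rho> h) = \<rho> k"
        unfolding \<rho>_def by (metis b fits_mult fits_star)
    qed
    then have 1: "U g * P = P * U g * P" using fU[OF g] P by (simp add: Q_def algebra_simps)
    have "Q * star (U g) * P = 0"
    proof (rule QWP[OF unitary_star[OF unit[OF g]]])
      fix h assume "h \<in> topspace T"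
      from inv[OF g this] show "\<exists>k\<in>topspace T. cj (star (U g)) (\<rho> h) = \<rho> k"
        unfolding \<rho>_def by (metis b fits_mult fits_star)
    qed
    then have "star (U g) * P = P * star (U g) * P" using fU[OF g] P by (simp add: Q_def algebra_simps)
    from arg_cong[OF this, of star] have "P * U g = P * U g * P" by (simp add: P mult.assoc)
    with 1 show ?thesis by simp
  qed
  have QU: "U g * Q = Q * U g" if g: "g \<in> topspace T" for g
    using UP[OF g] fU[OF g] by (simp add: Q_def algebra_simps)
  have sUP: "star (U g) * P = P * star (U g)" "star (U g) * Q = Q * star (U g)" if g: "g \<in> topspace T" for g
    using arg_cong[OF UP[OF g], of star] arg_cong[OF QU[OF g], of star] by (simp_all add: P Q)
  have AP: "P * (A j * P) = A j * P" if j: "j \<in> J" for j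
  proof -
    \<comment> \<open>Compressing the fixed-point equation of an orbit state by \<open>Q\<close>
      makes a sum of positive terms vanish, so each Kraus operator maps the support into
      itself.\<close>
    have "Q * A j * P = 0"
    proof (rule Pnull)
      fix g assume g: "g \<in> topspace T"
      define D where "D j = star (Q * A j * c g)" for j
      have "(\<Sum>j\<in>J. star (D j) * D j) = Q * (\<Sum>j\<in>J. A j * \<rho> g * star (A j)) * Q"
        by (simp add: D_def Q \<rho>c sum_distrib_left sum_distrib_right mult.assoc)
      also have "\<dots> = 0" by (simp add: fixed\<rho>[OF g] Q\<rho>[OF g])
      finally have "(\<Sum>j\<in>J. tr (star (D j) * D j)) = 0" by (simp flip: tr_sum)
      from sum_star_mult_zero[OF finJ this j] have "star (D j) = 0" by simp
      then have "Q * A j * c g = 0" by (simp add: D_def)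
      then show "Q * A j * \<rho> g = 0" unfolding \<rho>c by (simp flip: mult.assoc)
    qed
    then show ?thesis using fitsA[OF j] P by (simp add: Q_def algebra_simps)
  qed

  \<comment> \<open>Cutting down to the joint support \<open>P\<close> of the orbit and adding the Kraus operator \<open>Q = 1 - P\<close> turns
    the orbit together with \<open>Q\<close> into a faithful family of fixed points.\<close>
  define B where "B = case_option Q (\<lambda>j. A j * P)"
  define I where "I = insert None (Some ` J)"
  have B: "B None = Q" "B (Some j) = A j * P" for j by (simp_all add: B_def)
  interpret K: unital_kraus n I B
  proof
    show "finite I" using finJ by (simp add: I_def)
    show "fits n (B x)" if "x \<in> I" for x using that Q P fitsA by (auto simp: I_def B)
    have "(\<Sum>x\<in>I. star (B x) * B x) = Q + P * (\<Sum>j\<in>J. star (A j) * A j) * P"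
      by (simp add: I_def finJ sum.reindex B Q P sum_distrib_left sum_distrib_right mult.assoc)
    also have "\<dots> = P + Q" using P by (simp add: unital add.commute)
    finally show "(\<Sum>x\<in>I. star (B x) * B x) = idm n" by (simp add: Q)
  qed
  have KF: "K.F X = (\<Sum>j\<in>J. A j * (P * X * P) * star (A j)) + Q * X * Q" for X
    unfolding K.F_def by (simp add: I_def finJ sum.reindex B Q P mult.assoc add.commute)
  have KF\<rho>: "K.F (\<rho> g) = \<rho> g" if "g \<in> topspace T" for g
    by (simp add: KF P\<rho>[OF that] Q\<rho>[OF that] fixed\<rho>[OF that])
  have KFQ: "K.F Q = Q" by (simp add: KF Q)
  have KFcj: "K.F (cj (U g) X) = cj (U g) (K.F X)" if g: "g \<in> topspace T" and X: "fits n X" for g X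
  proof -
    have 1: "P * cj (U g) X * P = cj (U g) (P * X * P)"
      unfolding cj_def using UP[OF g] sUP[OF g] by (metis mult.assoc)
    have 2: "Q * cj (U g) X * Q = cj (U g) (Q * X * Q)"
      unfolding cj_def using QU[OF g] sUP[OF g] by (metis mult.assoc)
    show ?thesis unfolding KF 1 2 cj_add by (subst cov[OF g]) (simp_all add: P X)
  qed
  \<comment> \<open>The members are factors of fixed points of \<open>K.F\<close>; \<open>Q\<close>,
    being a projection, is its own factor.\<close>
  define R where "R = insert Q (c ` topspace T)"
  have faithful: "\<forall>Y. fits n Y \<and> (\<forall>b\<in>R. Y * b = 0) \<longrightarrow> Y = 0"
  proof (intro allI impI)
    fix Y assume Y: "fits n Y \<and> (\<forall>b\<in>R. Y * b = 0)"
    then have "Y * Q = 0" by (simp add: R_def)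
    moreover have "Y * P = 0" by (rule Pnull') (use Y in \<open>auto simp: R_def\<close>)
    ultimately have "Y * (P + Q) = 0" by (simp add: distrib_left)
    then show "Y = 0" using Y by (simp add: Q)
  qed
  have "\<forall>b\<in>R. fits n b \<and> K.F (b * star b) = b * star b"
    using fc KF\<rho> Q KFQ by (auto simp: R_def simp flip: \<rho>c)
  note commutes = K.fixed_commutes[OF faithful this]
  define Z where "Z = star (B (Some i)) * B (Some j)"
  have ijI: "Some i \<in> I" "Some j \<in> I" using i j by (auto simp: I_def)
  have Zf: "fits n Z" unfolding Z_def using K.fitsB ijI by simp
  obtain C where C: "fits n C" "K.L C = C"
    and Ccomm: "\<forall>X. (\<forall>x\<in>I. X * B x = B x * X \<and> X * star (B x) = star (B x) * X) \<and>
      X * Z = Z * X \<longrightarrow> X * C = C * X"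
    and Ctr: "\<forall>\<rho>. fits n \<rho> \<and> K.F \<rho> = \<rho> \<longrightarrow> tr (\<rho> * C) = tr (\<rho> * Z)"
    using K.ergodic_mean[OF Zf] by blast
  \<comment> \<open>\<open>Z\<close> is an adjoint of a Kraus operator times a Kraus operator, so
    every fixed point commutes with it and therefore with its ergodic mean.\<close>
  have central: "X * C = C * X" if X: "fits n X" "K.L X = X" for X
  proof -
    have 1: "X * B x = B x * X" "X * star (B x) = star (B x) * X" if "x \<in> I" for x
      using commutes[OF X that] by blast+
    have "X * Z = Z * X"
      unfolding Z_def by (metis 1 ijI mult.assoc)
    with 1 Ccomm show ?thesis by blast
  qed
  have Lstable: "K.L (cj (U g) X) = cj (U g) X" "K.L (cj (star (U g)) X) = cj (star (U g)) X"
    if "g \<in> topspace T" "fits n X" "K.L X = X" for g X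
    using K.L_cj[OF unit[OF that(1)] KFcj[OF that(1)] that(2)] that(3) by simp_all
  have const: "cj (U g) H = H"
    if H: "fits n H" "K.L H = H" "star H = H"
      and Hc: "\<And>X. fits n X \<Longrightarrow> K.L X = X \<Longrightarrow> X * H = H * X" for H
  proof -
    have "cj (U g) H = cj (U e) H"
    proof (rule commuting_orbit_constant[OF unit cont conn H(1,3) _ g e(1)])
      fix g h assume g: "g \<in> topspace T" and h: "h \<in> topspace T"
      \<comment> \<open>Pulling the desired commutation back by \<open>U h\<close> leaves
        \<open>H\<close> and the fixed point \<open>Y\<close>, which commute because
        \<open>H\<close> is central.\<close>
      define Y where "Y = cj (star (U h)) (cj (U g) H)"
      have Y: "fits n Y" "K.L Y = Y"
        unfolding Y_def using H g h unit unitary_star by (auto simp: Lstable)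
      have "cj (U h) Y = cj (U g) H" unfolding Y_def by (rule cj_cj_star) (use unit g h H in auto)
      moreover have "cj (U h) (Y * H) = cj (U h) (H * Y)" by (simp only: Hc[OF Y])
      ultimately show "cj (U g) H * cj (U h) H = cj (U h) H * cj (U g) H"
        using cj_mult[OF unit[OF h]] Y(1) H(1) by simp
    qed
    then show ?thesis using e(2) H(1) by simp
  qed
  have sC: "fits n (star C)" "K.L (star C) = star C" using C by (simp_all add: K.L_star)
  have scentral: "X * star C = star C * X" if X: "fits n X" "K.L X = X" for X
  proof -
    have "star X * C = C * star X" by (rule central) (simp_all add: X K.L_star)
    from arg_cong[OF this, of star] show ?thesis by simp
  qed
  \<comment> \<open>Rigidity of commuting orbits concerns Hermitian matrices, so it is applied to
    the two Hermitian parts of \<open>C\<close> separately.\<close>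
  have H1: "cj (U g) (C + star C) = C + star C"
    by (rule const) (simp_all add: C sC K.L_add add.commute distrib_left distrib_right central scentral)
  have H2: "cj (U g) (cs \<i> (C - star C)) = cs \<i> (C - star C)"
  proof (rule const)
    show "star (cs \<i> (C - star C)) = cs \<i> (C - star C)"
      by (intro fmat_eqI) (simp add: ent_cs ent_diff algebra_simps)
  qed (simp_all add: C sC K.L_cs K.L_diff cs_mult_left cs_mult_right left_diff_distrib
      right_diff_distrib central scentral)
  have split: "C = cs (1/2) (C + star C) + cs (-\<i>/2) (cs \<i> (C - star C))"
    by (intro fmat_eqI) (simp add: ent_cs ent_add ent_diff algebra_simps)
  have "cj (U g) (cs a X + cs b Y) = cs a X + cs b Y" if "cj (U g) X = X" "cj (U g) Y = Y" for a b X Y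
    using that by (simp add: cj_add cj_cs)
  from this[OF H1 H2, of "1/2" "-\<i>/2"] have "cj (U g) C = C" by (simp only: split[symmetric])
  then have "tr (\<rho> g * C) = tr (\<rho> g * cj (U g) C)" by simp
  also have "\<dots> = tr (cj (U g) (b * star b * C))"
    by (simp add: \<rho>_def cj_mult[OF unit[OF g]] b C)
  also have "\<dots> = tr (b * star b * C)"
  proof -
    have "tr (cj (U g) X) = tr X" if "fits n X" for X
      using unitaryD(3)[OF unit[OF g]] that
      by (simp add: cj_def mult.assoc tr_commute[of "U g"]) 
    then show ?thesis by (simp add: b C)
  qed
  finally have trC: "tr (\<rho> g * C) = tr (\<rho> e * C)" using e(2) b by (simp add: \<rho>_def)
  \<comment> \<open>The mean belongs to the operators cut down by \<open>P\<close>; the orbit states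
    absorb \<open>P\<close> on both sides, which restores the original product.\<close>
  have trZ: "tr (\<rho> h * (star (A i) * A j)) = tr (\<rho> h * C)" if h: "h \<in> topspace T" for h
  proof -
    have "tr (\<rho> h * C) = tr (\<rho> h * (P * (star (A i) * A j * P)))"
      using Ctr f\<rho>[OF h] KF\<rho>[OF h] by (simp add: Z_def B P mult.assoc)
    also have "\<dots> = tr (\<rho> h * P * (star (A i) * A j) * P)" by (simp add: mult.assoc)
    also have "\<dots> = tr (P * (\<rho> h * P * (star (A i) * A j)))" by (rule tr_commute)
    also have "\<dots> = tr (P * \<rho> h * (star (A i) * A j))" by (simp only: P\<rho>(2)[OF h] flip: mult.assoc)
    finally show ?thesis by (simp only: P\<rho>[OF h])
  qed
  have "\<rho> e = b * star b" using e(2) b by (simp add: \<rho>_def)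
  then show ?thesis using trC trZ[OF g] trZ[OF e(1)] by (simp add: \<rho>_def)
qed

section \<open>Kraus representation of channels\<close>

text \<open>Cholesky factorisation, eliminating the last index by a Schur complement.\<close>

lemma psd_factor:
  fixes a :: "nat \<Rightarrow> nat \<Rightarrow> complex"
  assumes "\<And>i j. i < n \<Longrightarrow> j < n \<Longrightarrow> a j i = cnj (a i j)"
    and "\<And>v. 0 \<le> Re (\<Sum>i<n. \<Sum>j<n. cnj (v i) * a i j * v j)"
  shows "\<exists>b. \<forall>i<n. \<forall>j<n. a i j = (\<Sum>k<n. b i k * cnj (b j k))"
  using assms
proof (induction n arbitrary: a)
  case 0
  then show ?case by simp
next
  case (Suc n)
  note herm = Suc.prems(1)
  have hn: "a i n = cnj (a n i)" if "i < n" for i using herm[of n i] that by simp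
  define q where "q a v = (\<Sum>i<n. \<Sum>j<n. cnj (v i) * a i j * v j)" for a :: "nat \<Rightarrow> nat \<Rightarrow> complex" and v
  have expand: "(\<Sum>i<Suc n. \<Sum>j<Suc n. cnj (v i) * a i j * v j) =
      q a v + cnj (\<Sum>j<n. a n j * v j) * v n + cnj (v n) * (\<Sum>j<n. a n j * v j) + cnj (v n) * a n n * v n" for v
  proof -
    have "(\<Sum>i<n. cnj (v i) * a i n * v n) = cnj (\<Sum>j<n. a n j * v j) * v n"
      unfolding cnj_sum sum_distrib_right
      by (intro sum.cong refl) (simp add: hn mult.commute)
    then show ?thesis by (simp add: q_def sum.distrib sum_distrib_left mult.assoc)
  qed
  have pos: "0 \<le> Re (q a v + cnj (\<Sum>j<n. a n j * v j) * v n + cnj (v n) * (\<Sum>j<n. a n j * v j) + cnj (v n) * a n n * v n)" for v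
    using Suc.prems(2)[of v] unfolding expand .
  define d where "d = Re (a n n)"
  have ann: "a n n = complex_of_real d"
    using arg_cong[OF herm[of n n], of Im] by (simp add: d_def complex_eq_iff)
  have "0 \<le> d"
    using pos[of "\<lambda>i. if i = n then 1 else 0"] by (simp add: q_def d_def)
  then consider "d = 0" | "d > 0" by linarith
  then show ?case
  proof cases
    case 1
    have zero: "a n i = 0" if i: "i < n" for i
    proof (rule ccontr)
      assume nz: "a n i \<noteq> 0"
      define m where "m = (cmod (a n i))\<^sup>2"
      have m: "m > 0" using nz by (simp add: m_def)
      \<comment> \<open>With a zero pivot the form is linear in \<open>t\<close>; this value makes
        its real part equal to -1.\<close>
      define t where "t = (Re (a i i) + 1) / (2 * m)"
      define v where "v = (\<lambda>j. if j = n then - complex_of_real t * a n i else if j = i then 1 else 0)"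
      have s: "(\<Sum>j<n. a n j * v j) = a n i"
      proof -
        have "(\<Sum>j<n. a n j * v j) = (\<Sum>j<n. if j = i then a n j else 0)"
          by (intro sum.cong refl) (auto simp: v_def)
        then show ?thesis using i by simp
      qed
      have "q a v = (\<Sum>k<n. \<Sum>j<n. if j = i then if k = i then a k j else 0 else 0)"
        unfolding q_def by (intro sum.cong refl) (auto simp: v_def)
      also have "\<dots> = a i i" using i by simp
      finally have qa: "q a v = a i i" .
      have zz: "complex_of_real m = a n i * cnj (a n i)" unfolding m_def by (rule complex_norm_square)
      have "v n = - complex_of_real t * a n i" by (simp add: v_def)
      then have "q a v + cnj (a n i) * v n + cnj (v n) * a n i + cnj (v n) * a n n * v n
          = a i i - complex_of_real (2 * (t * m))"
        unfolding qa ann 1 by (simp add: zz algebra_simps)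
      then have "0 \<le> Re (a i i - complex_of_real (2 * (t * m)))"
        using pos[of v] unfolding s by simp
      then have "0 \<le> Re (a i i) - 2 * (t * m)" by simp
      moreover have "2 * (t * m) = Re (a i i) + 1" using m by (simp add: t_def)
      ultimately show False by simp
    qed
    have "\<exists>b. \<forall>i<n. \<forall>j<n. a i j = (\<Sum>k<n. b i k * cnj (b j k))"
    proof (rule Suc.IH)
      fix v
      show "0 \<le> Re (\<Sum>i<n. \<Sum>j<n. cnj (v i) * a i j * v j)"
        using pos[of "\<lambda>i. if i = n then 0 else v i"] by (simp add: q_def)
    qed (rule herm; simp)
    then obtain b where b: "\<forall>i<n. \<forall>j<n. a i j = (\<Sum>k<n. b i k * cnj (b j k))" by blast
    show ?thesis
    proof (intro exI allI impI)
      fix i j assume "i < Suc n" "j < Suc n"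
      then show "a i j = (\<Sum>k<Suc n. (\<lambda>i k. if i = n \<or> k = n then 0 else b i k) i k *
          cnj ((\<lambda>i k. if i = n \<or> k = n then 0 else b i k) j k))"
        using b zero hn 1 ann by (auto simp: less_Suc_eq)
    qed
  next
    case 2
    define a' where "a' i j = a i j - a i n * a n j / complex_of_real d" for i j
    have "\<exists>b. \<forall>i<n. \<forall>j<n. a' i j = (\<Sum>k<n. b i k * cnj (b j k))"
    proof (rule Suc.IH)
      fix i j assume "i < n" "j < n"
      then show "a' j i = cnj (a' i j)"
        using herm[of i j] herm[of i n] herm[of n j] by (simp add: a'_def mult.commute)
    next
      fix v
      define s where "s = (\<Sum>j<n. a n j * v j)"
      \<comment> \<open>Completing the square: this last coordinate minimises the form, whose
        minimum is the Schur complement evaluated at \<open>v\<close>.\<close>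
      define w where "w = v(n := - s / complex_of_real d)"
      have sw: "(\<Sum>j<n. a n j * w j) = s" unfolding s_def w_def by (intro sum.cong refl) auto
      have qw: "q a w = q a v" unfolding q_def w_def by (intro sum.cong refl) auto
      have wn: "w n = - s / complex_of_real d" by (simp add: w_def)
      have sc: "(\<Sum>i<n. cnj (v i) * a i n) = cnj s"
        unfolding s_def cnj_sum by (intro sum.cong refl) (simp add: hn mult.commute)
      have "(\<Sum>i<n. \<Sum>j<n. cnj (v i) * a' i j * v j)
        = q a v - (\<Sum>i<n. \<Sum>j<n. (cnj (v i) * a i n) * (a n j * v j) / complex_of_real d)"
        unfolding q_def a'_def by (simp add: algebra_simps sum_subtractf)
      also have "(\<Sum>i<n. \<Sum>j<n. (cnj (v i) * a i n) * (a n j * v j) / complex_of_real d)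
        = (\<Sum>i<n. cnj (v i) * a i n) * s / complex_of_real d"
        unfolding s_def sum_product sum_divide_distrib ..
      finally have "(\<Sum>i<n. \<Sum>j<n. cnj (v i) * a' i j * v j) = q a v - cnj s * s / complex_of_real d"
        by (simp add: sc)
      also have "\<dots> = q a w + cnj (\<Sum>j<n. a n j * w j) * w n + cnj (w n) * (\<Sum>j<n. a n j * w j)
          + cnj (w n) * a n n * w n"
        unfolding sw qw wn ann using 2 by (simp add: field_simps)
      finally show "0 \<le> Re (\<Sum>i<n. \<Sum>j<n. cnj (v i) * a' i j * v j)" using pos[of w] by simp
    qed
    then obtain b where b: "\<forall>i<n. \<forall>j<n. a' i j = (\<Sum>k<n. b i k * cnj (b j k))" by blast
    define r where "r = complex_of_real (sqrt d)"
    have r: "r * r = complex_of_real d" "cnj r = r" "r \<noteq> 0"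
      using 2 by (auto simp: r_def simp flip: of_real_mult)
    define B where "B i k = (if k = n then a i n / r else if i = n then 0 else b i k)" for i k
    show ?thesis
    proof (intro exI allI impI)
      fix i j assume ij: "i < Suc n" "j < Suc n"
      have last: "B i n * cnj (B j n) = a i n * a n j / complex_of_real d"
        using herm[of n j] ij r by (simp add: B_def flip: r(1))
      show "a i j = (\<Sum>k<Suc n. B i k * cnj (B j k))"
      proof (cases "i < n \<and> j < n")
        case True
        then have "(\<Sum>k<n. B i k * cnj (B j k)) = a' i j"
          using b by (auto simp: B_def intro!: sum.cong)
        then show ?thesis by (simp add: last a'_def)
      next
        case False
        then have "(\<Sum>k<n. B i k * cnj (B j k)) = 0" by (intro sum.neutral) (use ij in \<open>auto simp: B_def\<close>)
        moreover have "a i n * a n j / complex_of_real d = a i j"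
          using False ij 2 ann by (auto simp: less_Suc_eq)
        ultimately show ?thesis by (simp add: last)
      qed
    qed
  qed
qed

lemma psd_matrix_factor:
  assumes "psd n A"
  obtains b where "\<And>i j. i < n \<Longrightarrow> j < n \<Longrightarrow> A $$ (i,j) = (\<Sum>k<n. b i k * cnj (b j k))"
proof -
  have A: "A \<in> carrier_mat n n" "dagger A = A" using assms by (auto simp: psd_def)
  have herm: "A $$ (j,i) = cnj (A $$ (i,j))" if "i < n" "j < n" for i j
    using arg_cong[OF A(2), of "\<lambda>M. M $$ (j,i)"] A(1) that by (simp add: dagger_def)
  have "\<exists>b. \<forall>i<n. \<forall>j<n. A $$ (i,j) = (\<Sum>k<n. b i k * cnj (b j k))"
    by (rule psd_factor[OF herm]) (use assms in \<open>simp_all add: psd_def\<close>)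
  then show thesis using that by blast
qed

lemma sum_divmod:
  fixes f :: "nat \<Rightarrow> 'a::comm_monoid_add"
  shows "(\<Sum>p<a * b. f p) = (\<Sum>i<a. \<Sum>k<b. f (i * b + k))"
proof -
  have "sum f {i * b..<i * b + b} = (\<Sum>k<b. f (i * b + k))" for i
    using sum.shift_bounds_nat_ivl[of f 0 "i * b" b] by (simp add: lessThan_atLeast0 add.commute)
  then show ?thesis by (simp flip: sum.nat_group)
qed

lemma index_lt: "i < a \<Longrightarrow> k < b \<Longrightarrow> i * b + k < a * (b::nat)"
proof -
  assume "i < a" "k < b"
  then have "i * b + k < Suc i * b" "Suc i * b \<le> a * b" by (simp, intro mult_le_mono1, simp)
  then show ?thesis by (rule less_le_trans)
qed

definition munit :: "nat \<Rightarrow> nat \<Rightarrow> nat \<Rightarrow> complex mat" where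
  "munit d y z = mat d d (\<lambda>(i,j). if i = y \<and> j = z then 1 else 0)"

lemma channel_entry_linear:
  assumes E: "channel d E" and X: "X \<in> carrier_mat d d" and xw: "x < d" "w < d"
  shows "E X $$ (x,w) = (\<Sum>y<d. \<Sum>z<d. X $$ (y,z) * E (munit d y z) $$ (x,w))"
proof -
  have car: "E X \<in> carrier_mat d d" if "X \<in> carrier_mat d d" for X using E that by (simp add: channel_def)
  have lin: "E (c \<cdot>\<^sub>m X + Y) = c \<cdot>\<^sub>m E X + E Y"
    if "X \<in> carrier_mat d d" "Y \<in> carrier_mat d d" for c X Y using E that by (simp add: channel_def)
  define R where "R S = mat d d (\<lambda>(i,j). if (i,j) \<in> S then X $$ (i,j) else 0)" for S
  have Rc: "R S \<in> carrier_mat d d" for S by (simp add: R_def)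
  have uc: "munit d y z \<in> carrier_mat d d" for y z by (simp add: munit_def)
  have "E (R S) $$ (x,w) = (\<Sum>(y,z)\<in>S. X $$ (y,z) * E (munit d y z) $$ (x,w))"
    if "finite S" "S \<subseteq> {..<d} \<times> {..<d}" for S
    using that
  proof (induction S rule: finite_induct)
    case empty
    \<comment> \<open>The zero matrix is its own double, so additivity forces its image to
      vanish.\<close>
    have "1 \<cdot>\<^sub>m R {} + R {} = R {}" by (rule eq_matI) (auto simp: R_def)
    then have "E (R {}) = 1 \<cdot>\<^sub>m E (R {}) + E (R {})" using lin[OF Rc Rc] by metis
    from arg_cong[OF this, of "\<lambda>M. M $$ (x,w)"] show ?case using car[OF Rc, of "{}"] xw by simp
  next
    case (insert p S)
    obtain y z where p: "p = (y,z)" by (cases p)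
    have "R (insert p S) = X $$ (y,z) \<cdot>\<^sub>m munit d y z + R S"
      using insert by (intro eq_matI) (auto simp: R_def munit_def p)
    then have "E (R (insert p S)) = X $$ (y,z) \<cdot>\<^sub>m E (munit d y z) + E (R S)"
      using lin[OF uc Rc] by metis
    from arg_cong[OF this, of "\<lambda>M. M $$ (x,w)"]
    show ?case using insert car[OF Rc, of S] car[OF uc, of y z] xw by (simp add: p)
  qed
  from this[of "{..<d} \<times> {..<d}"]
  have "E (R ({..<d} \<times> {..<d})) $$ (x,w) = (\<Sum>y<d. \<Sum>z<d. X $$ (y,z) * E (munit d y z) $$ (x,w))"
    by (simp add: sum.cartesian_product)
  moreover have "R ({..<d} \<times> {..<d}) = X" using X by (intro eq_matI) (auto simp: R_def)
  ultimately show ?thesis by simp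
qed

text \<open>The Kraus operators are read off a factorisation of the Choi matrix, the image of the
  unnormalised maximally entangled state under \<open>E\<close> tensored with the identity.\<close>

lemma channel_kraus:
  assumes E: "channel d E"
  shows "\<exists>K. \<forall>X\<in>carrier_mat d d. \<forall>x<d. \<forall>w<d.
    E X $$ (x,w) = (\<Sum>a<d * d. \<Sum>y<d. \<Sum>z<d. K a x y * X $$ (y,z) * cnj (K a w z))"
proof -
  define o1 :: "nat \<Rightarrow> complex" where "o1 p = (if p div d = p mod d then 1 else 0)" for p
  define Om where "Om = mat (d * d) (d * d) (\<lambda>(p,q). o1 p * o1 q)"
  have "psd (d * d) Om"
    unfolding psd_def
  proof (intro conjI allI)
    show "dagger Om = Om" by (rule eq_matI) (auto simp: dagger_def Om_def o1_def)
    fix v :: "nat \<Rightarrow> complex"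
    have "(\<Sum>i<d * d. \<Sum>j<d * d. cnj (v i) * Om $$ (i,j) * v j) = cnj (\<Sum>i<d * d. o1 i * v i) * (\<Sum>j<d * d. o1 j * v j)"
      unfolding cnj_sum sum_product
      by (intro sum.cong refl) (auto simp: Om_def o1_def)
    moreover have "0 \<le> Re (cnj z * z)" for z by simp
    ultimately show "0 \<le> Re (\<Sum>i<d * d. \<Sum>j<d * d. cnj (v i) * Om $$ (i,j) * v j)" by metis
  qed (simp add: Om_def)
  then have "psd (d * d) (ext_id d d E Om)" using E by (simp add: channel_def)
  then obtain b where b: "\<And>p q. p < d * d \<Longrightarrow> q < d * d \<Longrightarrow>
    ext_id d d E Om $$ (p,q) = (\<Sum>k<d * d. b p k * cnj (b q k))" using psd_matrix_factor by metis
  \<comment> \<open>In the Choi matrix the output index is slow and the ancilla index fast; the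
    latter becomes the input index of the Kraus operator.\<close>
  define K where "K a x y = b (x * d + y) a" for a x y
  have choi: "E (munit d y z) $$ (x,w) = (\<Sum>a<d * d. K a x y * cnj (K a w z))"
    if "x < d" "y < d" "w < d" "z < d" for x y w z
  proof -
    have "mat d d (\<lambda>(i,j). Om $$ (i * d + y, j * d + z)) = munit d y z"
      using that by (intro eq_matI) (auto simp: Om_def munit_def o1_def index_lt)
    then have "ext_id d d E Om $$ (x * d + y, w * d + z) = E (munit d y z) $$ (x,w)"
      using that by (simp add: ext_id_def index_lt)
    then show ?thesis using b[of "x * d + y" "w * d + z"] that by (simp add: K_def index_lt)
  qed
  show ?thesis
  proof (intro exI[of _ K] ballI allI impI)
    fix X :: "complex mat" and x w assume X: "X \<in> carrier_mat d d" and x: "x < d" and w: "w < d"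
    have "E X $$ (x,w) = (\<Sum>y<d. \<Sum>z<d. \<Sum>a<d * d. K a x y * X $$ (y,z) * cnj (K a w z))"
      unfolding channel_entry_linear[OF E X x w]
      by (intro sum.cong refl) (simp add: choi x w sum_distrib_left mult_ac)
    also have "\<dots> = (\<Sum>y<d. \<Sum>a<d * d. \<Sum>z<d. K a x y * X $$ (y,z) * cnj (K a w z))"
      by (intro sum.cong refl sum.swap)
    also have "\<dots> = (\<Sum>a<d * d. \<Sum>y<d. \<Sum>z<d. K a x y * X $$ (y,z) * cnj (K a w z))"
      by (rule sum.swap)
    finally show "E X $$ (x,w) = (\<Sum>a<d * d. \<Sum>y<d. \<Sum>z<d. K a x y * X $$ (y,z) * cnj (K a w z))" .
  qed
qed

section \<open>Bipartite systems\<close>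

text \<open>The indices of the second factor select a block: \<open>block dR dS k l Y\<close> is \<open>\<langle>k|Y|l\<rangle>\<close>, a matrix on the
  first factor.\<close>

definition block :: "nat \<Rightarrow> nat \<Rightarrow> nat \<Rightarrow> nat \<Rightarrow> complex mat \<Rightarrow> fmat" where
  "block dR dS k l Y = fm dR (\<lambda>x w. Y $$ (x * dS + k, w * dS + l))"

lemma fits_block [simp]: "fits dR (block dR dS k l Y)" by (simp add: block_def)

lemma of_mat_ptrace_S: "of_mat dR (ptrace_S dR dS Y) = (\<Sum>k<dS. block dR dS k k Y)"
  by (rule fmat_eqI_fits[of dR]) (auto simp: ent_of_mat ptrace_S_def ent_sum block_def ent_fm)

lemma ptrace_R_entry: "k < dS \<Longrightarrow> l < dS \<Longrightarrow> ptrace_R dR dS Y $$ (k,l) = tr (block dR dS k l Y)"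
  by (simp add: ptrace_R_def tr_eq[where n=dR] block_def ent_fm)

lemma kron_entry:
  assumes "A \<in> carrier_mat a a" "B \<in> carrier_mat b b" "i < a" "j < a" "k < b" "l < b"
  shows "kron A B $$ (i * b + k, j * b + l) = A $$ (i,j) * B $$ (k,l)"
  using assms by (simp add: kron_def index_lt)

lemma kron_carrier: "A \<in> carrier_mat a a \<Longrightarrow> B \<in> carrier_mat b b \<Longrightarrow> kron A B \<in> carrier_mat (a * b) (a * b)"
  by (auto simp: kron_def)

lemma dagger_carrier: "A \<in> carrier_mat n n \<Longrightarrow> dagger A \<in> carrier_mat n n"
  by (auto simp: dagger_def)

lemma conj_by_carrier: "U \<in> carrier_mat n n \<Longrightarrow> X \<in> carrier_mat n n \<Longrightarrow> conj_by U X \<in> carrier_mat n n"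
  by (auto simp: conj_by_def dagger_def)

lemma conj_by_entry:
  assumes "U \<in> carrier_mat n n" "X \<in> carrier_mat n n" "i < n" "j < n"
  shows "conj_by U X $$ (i,j) = (\<Sum>q<n. \<Sum>p<n. U $$ (i,p) * X $$ (p,q) * cnj (U $$ (j,q)))"
  using assms by (simp add: conj_by_def dagger_def scalar_prod_def lessThan_atLeast0 sum_distrib_right)

lemma of_mat_conj_by:
  "U \<in> carrier_mat n n \<Longrightarrow> X \<in> carrier_mat n n \<Longrightarrow> of_mat n (conj_by U X) = cj (of_mat n U) (of_mat n X)"
  by (simp add: conj_by_def cj_def of_mat_mult of_mat_dagger dagger_carrier)

lemma sum_swap4:
  "(\<Sum>b\<in>B. \<Sum>t\<in>T. \<Sum>a\<in>A. \<Sum>s\<in>S. f a s b t) = (\<Sum>s\<in>S. \<Sum>t\<in>T. \<Sum>b\<in>B. \<Sum>a\<in>A. f a s b t)"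
  (is "?l = _")
proof -
  have "?l = (\<Sum>b\<in>B. \<Sum>t\<in>T. \<Sum>s\<in>S. \<Sum>a\<in>A. f a s b t)" by (intro sum.cong refl sum.swap)
  also have "\<dots> = (\<Sum>b\<in>B. \<Sum>s\<in>S. \<Sum>t\<in>T. \<Sum>a\<in>A. f a s b t)" by (intro sum.cong refl sum.swap)
  also have "\<dots> = (\<Sum>s\<in>S. \<Sum>b\<in>B. \<Sum>t\<in>T. \<Sum>a\<in>A. f a s b t)" by (rule sum.swap)
  also have "\<dots> = (\<Sum>s\<in>S. \<Sum>t\<in>T. \<Sum>b\<in>B. \<Sum>a\<in>A. f a s b t)" by (intro sum.cong refl sum.swap)
  finally show ?thesis .
qed

text \<open>Both partial traces are read off from this formula: the trace of a block removes
  \<open>U\<close>, and summing the diagonal blocks removes \<open>V\<close> by unitarity.\<close>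

lemma block_conj_kron:
  assumes U: "U \<in> carrier_mat dR dR" and V: "V \<in> carrier_mat dS dS"
    and Y: "Y \<in> carrier_mat (dR * dS) (dR * dS)" and kl: "k < dS" "l < dS"
  shows "block dR dS k l (conj_by (kron U V) Y) =
    (\<Sum>s<dS. \<Sum>t<dS. cs (V $$ (k,s) * cnj (V $$ (l,t))) (cj (of_mat dR U) (block dR dS s t Y)))"
proof (rule fmat_eqI_fits[of dR])
  fix x w assume xw: "x < dR" "w < dR"
  let ?K = "kron U V"
  have "ent (block dR dS k l (conj_by ?K Y)) x w
    = (\<Sum>b<dR. \<Sum>t<dS. \<Sum>a<dR. \<Sum>s<dS. ?K $$ (x * dS + k, a * dS + s) *
        Y $$ (a * dS + s, b * dS + t) * cnj (?K $$ (w * dS + l, b * dS + t)))"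
    using xw kl by (simp add: block_def ent_fm conj_by_entry[OF kron_carrier[OF U V] Y] index_lt sum_divmod)
  also have "\<dots> = (\<Sum>b<dR. \<Sum>t<dS. \<Sum>a<dR. \<Sum>s<dS. V $$ (k,s) * cnj (V $$ (l,t)) *
        (U $$ (x,a) * Y $$ (a * dS + s, b * dS + t) * cnj (U $$ (w,b))))"
    by (intro sum.cong refl) (insert xw kl; simp add: kron_entry[OF U V]; simp add: mult_ac)
  also have "\<dots> = (\<Sum>s<dS. \<Sum>t<dS. \<Sum>b<dR. \<Sum>a<dR. V $$ (k,s) * cnj (V $$ (l,t)) *
        (U $$ (x,a) * Y $$ (a * dS + s, b * dS + t) * cnj (U $$ (w,b))))"
    by (rule sum_swap4)
  also have "\<dots> = ent (\<Sum>s<dS. \<Sum>t<dS. cs (V $$ (k,s) * cnj (V $$ (l,t))) (cj (of_mat dR U) (block dR dS s t Y))) x w"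
    unfolding ent_sum ent_cs
    by (intro sum.cong refl)
      (use xw in \<open>simp add: cj_def ent_mult[where n=dR] ent_star ent_of_mat block_def ent_fm sum_distrib_left sum_distrib_right\<close>)
  finally show "ent (block dR dS k l (conj_by ?K Y)) x w = ent (\<Sum>s<dS. \<Sum>t<dS. cs (V $$ (k,s) * cnj (V $$ (l,t))) (cj (of_mat dR U) (block dR dS s t Y))) x w" .
qed (auto intro!: fits_sum fits_cs fits_mult simp: cj_def)

lemma unitary_of_mat:
  assumes "unitary_mat n U" shows "unitary n (of_mat n U)"
proof -
  have U: "U \<in> carrier_mat n n" "dagger U * U = 1\<^sub>m n" "U * dagger U = 1\<^sub>m n"
    using assms by (auto simp: unitary_mat_def)
  note D = dagger_carrier[OF U(1)]
  show ?thesis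
    unfolding unitary_def of_mat_dagger[OF U(1), symmetric] of_mat_mult[OF U(1) D, symmetric]
      of_mat_mult[OF D U(1), symmetric] U(2,3) of_mat_one by simp
qed

lemma ptrace_R_conj_kron:
  assumes U: "unitary_mat dR U" and V: "V \<in> carrier_mat dS dS"
    and Y: "Y \<in> carrier_mat (dR * dS) (dR * dS)"
  shows "ptrace_R dR dS (conj_by (kron U V) Y) = conj_by V (ptrace_R dR dS Y)"
proof (rule eq_matI)
  have Uc: "U \<in> carrier_mat dR dR" using U by (simp add: unitary_mat_def)
  have P: "ptrace_R dR dS Z \<in> carrier_mat dS dS" for Z by (simp add: ptrace_R_def)
  fix k l assume "k < dim_row (conj_by V (ptrace_R dR dS Y))" "l < dim_col (conj_by V (ptrace_R dR dS Y))"
  then have kl: "k < dS" "l < dS" using conj_by_carrier[OF V P[of Y]] by auto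
  have trcj: "tr (cj (of_mat dR U) X) = tr X" if "fits dR X" for X
    using unitaryD(3)[OF unitary_of_mat[OF U]] that
    by (simp add: cj_def mult.assoc tr_commute[of "of_mat dR U"])
  show "ptrace_R dR dS (conj_by (kron U V) Y) $$ (k,l) = conj_by V (ptrace_R dR dS Y) $$ (k,l)"
    unfolding conj_by_entry[OF V P kl] ptrace_R_entry[OF kl] block_conj_kron[OF Uc V Y kl]
    by (subst sum.swap)
      (simp add: tr_sum tr_cs trcj ptrace_R_entry mult_ac)
qed (use V in \<open>auto simp: ptrace_R_def conj_by_def dagger_def\<close>)

lemma ptrace_S_conj_kron:
  assumes U: "U \<in> carrier_mat dR dR" and V: "unitary_mat dS V"
    and Y: "Y \<in> carrier_mat (dR * dS) (dR * dS)"
  shows "of_mat dR (ptrace_S dR dS (conj_by (kron U V) Y)) = cj (of_mat dR U) (of_mat dR (ptrace_S dR dS Y))"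
proof -
  have Vc: "V \<in> carrier_mat dS dS" using V by (simp add: unitary_mat_def)
  have orth: "(\<Sum>k<dS. V $$ (k,s) * cnj (V $$ (k,t))) = (if s = t then 1 else 0)" if st: "s < dS" "t < dS" for s t
  proof -
    have "(dagger V * V) $$ (t,s) = (1\<^sub>m dS :: complex mat) $$ (t,s)" using V by (simp add: unitary_mat_def)
    then show ?thesis
      using Vc st by (auto simp: dagger_def scalar_prod_def lessThan_atLeast0 mult.commute)
  qed
  let ?G = "\<lambda>s t. cj (of_mat dR U) (block dR dS s t Y)"
  have cs_sum_left: "(\<Sum>k\<in>S. cs (c k) X) = cs (sum c S) X" for S :: "nat set" and c X
    by (rule fmat_eqI) (simp add: ent_sum ent_cs sum_distrib_right)
  have "of_mat dR (ptrace_S dR dS (conj_by (kron U V) Y))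
    = (\<Sum>k<dS. \<Sum>s<dS. \<Sum>t<dS. cs (V $$ (k,s) * cnj (V $$ (k,t))) (?G s t))"
    unfolding of_mat_ptrace_S by (intro sum.cong refl block_conj_kron U Vc Y) auto
  also have "\<dots> = (\<Sum>s<dS. \<Sum>k<dS. \<Sum>t<dS. cs (V $$ (k,s) * cnj (V $$ (k,t))) (?G s t))"
    by (rule sum.swap)
  also have "\<dots> = (\<Sum>s<dS. \<Sum>t<dS. \<Sum>k<dS. cs (V $$ (k,s) * cnj (V $$ (k,t))) (?G s t))"
    by (intro sum.cong refl sum.swap)
  also have "\<dots> = (\<Sum>s<dS. \<Sum>t<dS. if s = t then ?G s t else 0)"
    by (intro sum.cong refl) (auto simp: cs_sum_left orth intro!: fmat_eqI simp: ent_cs ent_zero)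
  also have "\<dots> = cj (of_mat dR U) (of_mat dR (ptrace_S dR dS Y))"
    by (simp add: of_mat_ptrace_S cj_sum)
  finally show ?thesis .
qed

lemma conj_by_kron:
  assumes U: "U \<in> carrier_mat a a" and V: "V \<in> carrier_mat b b"
    and X: "X \<in> carrier_mat a a" and Y: "Y \<in> carrier_mat b b"
  shows "conj_by (kron U V) (kron X Y) = kron (conj_by U X) (conj_by V Y)"
proof (rule eq_matI)
  note K = kron_carrier[OF U V] kron_carrier[OF X Y]
  note C = conj_by_carrier[OF U X] conj_by_carrier[OF V Y]
  fix p q assume "p < dim_row (kron (conj_by U X) (conj_by V Y))" "q < dim_col (kron (conj_by U X) (conj_by V Y))"
  then have pq: "p < a * b" "q < a * b" using kron_carrier[OF C] by auto
  then have b: "0 < b" by (cases b) auto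
  define i k j l where ikjl: "i = p div b" "k = p mod b" "j = q div b" "l = q mod b"
  have lt: "i < a" "k < b" "j < a" "l < b"
    using pq b by (auto simp: ikjl less_mult_imp_div_less)
  have eq: "p = i * b + k" "q = j * b + l" by (simp_all add: ikjl)
  have "conj_by (kron U V) (kron X Y) $$ (p,q)
    = (\<Sum>c<a. \<Sum>t<b. \<Sum>e<a. \<Sum>s<b. kron U V $$ (i * b + k, e * b + s) *
        kron X Y $$ (e * b + s, c * b + t) * cnj (kron U V $$ (j * b + l, c * b + t)))"
    using lt unfolding eq by (simp add: conj_by_entry[OF K] index_lt sum_divmod)
  also have "\<dots> = (\<Sum>c<a. \<Sum>t<b. \<Sum>e<a. \<Sum>s<b. (U $$ (i,e) * X $$ (e,c) * cnj (U $$ (j,c))) *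
        (V $$ (k,s) * Y $$ (s,t) * cnj (V $$ (l,t))))"
    by (intro sum.cong refl) (insert lt; simp add: kron_entry[OF U V] kron_entry[OF X Y]; simp add: mult_ac)
  also have "\<dots> = conj_by U X $$ (i,j) * conj_by V Y $$ (k,l)"
    by (simp only: conj_by_entry[OF U X lt(1,3)] conj_by_entry[OF V Y lt(2,4)] sum_product)
  finally show "conj_by (kron U V) (kron X Y) $$ (p,q) = kron (conj_by U X) (conj_by V Y) $$ (p,q)"
    using lt unfolding eq by (simp add: kron_entry[OF C])
qed (use U V X Y in \<open>auto simp: conj_by_def kron_def dagger_def\<close>)

text \<open>Factoring \<open>\<tau>\<close> turns the map that appends it into one with a Kraus
  operator per column of \<open>\<beta>\<close>. Composing these with the Kraus operators of
  \<open>E\<close> and splitting by the output index \<open>k\<close> on \<open>S\<close> gives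
  \<open>A m k\<close>, where \<open>m\<close> pairs a Kraus index of \<open>E\<close> with a column
  of \<open>\<beta>\<close>.\<close>

lemma channel_stinespring:
  assumes E: "channel (dR * dS) E" and \<tau>: "psd dS \<tau>"
  shows "\<exists>(M :: (nat \<times> nat) set) A. finite M \<and> (\<forall>m k. fits dR (A m k)) \<and>
    (\<forall>\<sigma>\<in>carrier_mat dR dR. \<forall>k<dS. \<forall>l<dS.
      block dR dS k l (E (kron \<sigma> \<tau>)) = (\<Sum>m\<in>M. A m k * of_mat dR \<sigma> * star (A m l)))"
proof -
  obtain \<beta> where \<beta>: "\<And>i j. i < dS \<Longrightarrow> j < dS \<Longrightarrow> \<tau> $$ (i,j) = (\<Sum>k<dS. \<beta> i k * cnj (\<beta> j k))"
    using psd_matrix_factor[OF \<tau>] by metis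
  have \<tau>c: "\<tau> \<in> carrier_mat dS dS" using \<tau> by (simp add: psd_def)
  define d where "d = dR * dS"
  obtain K where "\<forall>X\<in>carrier_mat d d. \<forall>x<d. \<forall>w<d.
    E X $$ (x,w) = (\<Sum>a<d * d. \<Sum>y<d. \<Sum>z<d. K a x y * X $$ (y,z) * cnj (K a w z))"
    using channel_kraus[OF E[folded d_def]] by blast
  then have K: "E X $$ (x,w) = (\<Sum>a<d * d. \<Sum>y<d. \<Sum>z<d. K a x y * X $$ (y,z) * cnj (K a w z))"
    if "X \<in> carrier_mat d d" "x < d" "w < d" for X x w using that by blast
  define A where "A m k = fm dR (\<lambda>x i. \<Sum>s<dS. K (fst m) (x * dS + k) (i * dS + s) * \<beta> s (snd m))" for m k
  show ?thesis
  proof (intro exI[of _ "{..<d * d} \<times> {..<dS}"] exI[of _ A] conjI ballI allI impI)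
    show "fits dR (A m k)" for m k by (simp add: A_def)
    fix \<sigma> :: "complex mat" and k l assume \<sigma>: "\<sigma> \<in> carrier_mat dR dR" and kl: "k < dS" "l < dS"
    show "block dR dS k l (E (kron \<sigma> \<tau>)) = (\<Sum>m\<in>{..<d * d} \<times> {..<dS}. A m k * of_mat dR \<sigma> * star (A m l))"
    proof (rule fmat_eqI_fits[of dR])
      fix x w assume xw: "x < dR" "w < dR"
      let ?f = "\<lambda>a c i s j t. (K a (x * dS + k) (i * dS + s) * \<beta> s c) * \<sigma> $$ (i,j) *
        cnj (K a (w * dS + l) (j * dS + t) * \<beta> t c)"
      have "ent (block dR dS k l (E (kron \<sigma> \<tau>))) x w =
        (\<Sum>a<d * d. \<Sum>i<dR. \<Sum>s<dS. \<Sum>j<dR. \<Sum>t<dS. K a (x * dS + k) (i * dS + s) *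
          kron \<sigma> \<tau> $$ (i * dS + s, j * dS + t) * cnj (K a (w * dS + l) (j * dS + t)))"
        using xw kl K[OF kron_carrier[OF \<sigma> \<tau>c, folded d_def]]
        by (simp add: block_def ent_fm index_lt d_def sum_divmod)
      also have "\<dots> = (\<Sum>a<d * d. \<Sum>i<dR. \<Sum>s<dS. \<Sum>j<dR. \<Sum>t<dS. \<Sum>c<dS. ?f a c i s j t)"
        by (intro sum.cong refl)
          (simp add: kron_entry[OF \<sigma> \<tau>c] \<beta> sum_distrib_left sum_distrib_right mult_ac)
      \<comment> \<open>The interchanges move the label \<open>(a, c)\<close> outward and leave the
        other indices in the order in which the triple product on \<open>R\<close> expands.\<close>
      also have "\<dots> = (\<Sum>a<d * d. \<Sum>i<dR. \<Sum>s<dS. \<Sum>j<dR. \<Sum>c<dS. \<Sum>t<dS. ?f a c i s j t)"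
        by (intro sum.cong refl sum.swap)
      also have "\<dots> = (\<Sum>a<d * d. \<Sum>i<dR. \<Sum>s<dS. \<Sum>c<dS. \<Sum>j<dR. \<Sum>t<dS. ?f a c i s j t)"
        by (intro sum.cong refl sum.swap)
      also have "\<dots> = (\<Sum>a<d * d. \<Sum>i<dR. \<Sum>c<dS. \<Sum>s<dS. \<Sum>j<dR. \<Sum>t<dS. ?f a c i s j t)"
        by (intro sum.cong refl sum.swap)
      also have "\<dots> = (\<Sum>a<d * d. \<Sum>c<dS. \<Sum>i<dR. \<Sum>s<dS. \<Sum>j<dR. \<Sum>t<dS. ?f a c i s j t)"
        by (intro sum.cong refl sum.swap)
      also have "\<dots> = (\<Sum>a<d * d. \<Sum>c<dS. \<Sum>i<dR. \<Sum>j<dR. \<Sum>s<dS. \<Sum>t<dS. ?f a c i s j t)"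
        by (intro sum.cong refl sum.swap)
      also have "\<dots> = (\<Sum>a<d * d. \<Sum>c<dS. \<Sum>j<dR. \<Sum>i<dR. \<Sum>s<dS. \<Sum>t<dS. ?f a c i s j t)"
        by (intro sum.cong refl sum.swap)
      also have "\<dots> = (\<Sum>a<d * d. \<Sum>c<dS. \<Sum>j<dR. \<Sum>i<dR. \<Sum>t<dS. \<Sum>s<dS. ?f a c i s j t)"
        by (intro sum.cong refl sum.swap)
      also have "\<dots> = (\<Sum>a<d * d. \<Sum>c<dS. \<Sum>j<dR. \<Sum>t<dS. \<Sum>i<dR. \<Sum>s<dS. ?f a c i s j t)"
        by (intro sum.cong refl sum.swap)
      also have "\<dots> = (\<Sum>a<d * d. \<Sum>c<dS. ent (A (a,c) k * of_mat dR \<sigma> * star (A (a,c) l)) x w)"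
        by (intro sum.cong refl)
          (use xw in \<open>simp add: ent_mult[where n=dR] A_def ent_fm ent_of_mat ent_star sum_product
            sum_distrib_left sum_distrib_right\<close>)
      also have "\<dots> = ent (\<Sum>m\<in>{..<d * d} \<times> {..<dS}. A m k * of_mat dR \<sigma> * star (A m l)) x w"
        by (simp add: ent_sum sum.cartesian_product case_prod_unfold)
      finally show "ent (block dR dS k l (E (kron \<sigma> \<tau>))) x w =
        ent (\<Sum>m\<in>{..<d * d} \<times> {..<dS}. A m k * of_mat dR \<sigma> * star (A m l)) x w" .
    qed (auto intro!: fits_sum fits_mult simp: A_def)
  qed simp
qed

section \<open>No broadcasting of asymmetry\<close>

text \<open>The phase meets its conjugate, so a projective representation acts genuinely by
  conjugation.\<close>

lemma cj_cs_unit: "cmod c = 1 \<Longrightarrow> cj (cs c W) X = cj W X"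
proof -
  assume "cmod c = 1"
  then have "c * cnj c = 1" by (simp flip: complex_norm_square)
  then show ?thesis by (simp add: cj_def cs_mult_left cs_mult_right mult.commute)
qed

lemma mtrace_kron:
  assumes "A \<in> carrier_mat a a" "B \<in> carrier_mat b b"
  shows "mtrace (kron A B) = mtrace A * mtrace B"
proof -
  have "mtrace (kron A B) = (\<Sum>i<a. \<Sum>k<b. kron A B $$ (i * b + k, i * b + k))"
    using carrier_matD(1)[OF kron_carrier[OF assms]] by (simp add: mtrace_def sum_divmod)
  also have "\<dots> = (\<Sum>i<a. \<Sum>k<b. A $$ (i,i) * B $$ (k,k))"
    by (intro sum.cong refl) (simp add: kron_entry[OF assms])
  finally show ?thesis using assms by (simp add: mtrace_def sum_product)
qed

lemma mtrace_block:
  assumes "Y \<in> carrier_mat (dR * dS) (dR * dS)"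
  shows "mtrace Y = (\<Sum>k<dS. tr (block dR dS k k Y))"
proof -
  have "mtrace Y = (\<Sum>i<dR. \<Sum>k<dS. Y $$ (i * dS + k, i * dS + k))"
    using carrier_matD(1)[OF assms] by (simp add: mtrace_def sum_divmod)
  also have "\<dots> = (\<Sum>k<dS. \<Sum>i<dR. Y $$ (i * dS + k, i * dS + k))" by (rule sum.swap)
  also have "\<dots> = (\<Sum>k<dS. tr (block dR dS k k Y))" by (simp add: tr_eq[where n=dR] block_def ent_fm)
  finally show ?thesis .
qed

lemma of_mat_surj:
  assumes "fits n S" obtains X where "X \<in> carrier_mat n n" "of_mat n X = S"
proof
  show "mat n n (\<lambda>(i,j). ent S i j) \<in> carrier_mat n n" by simp
  show "of_mat n (mat n n (\<lambda>(i,j). ent S i j)) = S"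
    by (rule fmat_eqI_fits[of n]) (auto simp: ent_of_mat assms)
qed

lemma tr_of_mat: "X \<in> carrier_mat n n \<Longrightarrow> tr (of_mat n X) = mtrace X"
  by (simp add: tr_eq[where n=n] mtrace_def ent_of_mat)

theorem theorem2:
  fixes G :: "('g, 'b) monoid_scheme" and T :: "'g topology"
    and dR dS :: nat and UR US :: "'g \<Rightarrow> complex mat"
    and \<rho>R \<rho>S :: "complex mat" and E :: "complex mat \<Rightarrow> complex mat"
  assumes "connected_topological_group G T"
    and "proj_unitary_rep G T dR UR"
    and "proj_unitary_rep G T dS US"
    and "density dR \<rho>R"
    and "density dS \<rho>S"
    and "symmetric_state G US \<rho>S"
    and "channel (dR * dS) E"
    and "covariant G (dR * dS) UR US E"
    and "ptrace_S dR dS (E (kron \<rho>R \<rho>S)) = \<rho>R"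
  shows "symmetric_state G US (ptrace_R dR dS (E (kron \<rho>R \<rho>S)))"
proof -
  have grp: "group G" and top: "topspace T = carrier G" and conn: "connected_space T"
    using assms(1) by (auto simp: connected_topological_group_def)
  interpret G: group G by (rule grp)
  have URu: "unitary_mat dR (UR g)" and USu: "unitary_mat dS (US g)" if "g \<in> carrier G" for g
    using assms(2,3) that by (auto simp: proj_unitary_rep_def)
  have URc: "UR g \<in> carrier_mat dR dR" and USc: "US g \<in> carrier_mat dS dS" if "g \<in> carrier G" for g
    using URu[OF that] USu[OF that] by (auto simp: unitary_mat_def)
  have \<rho>Rc: "\<rho>R \<in> carrier_mat dR dR" and \<rho>Rp: "psd dR \<rho>R"
    and \<rho>Sc: "\<rho>S \<in> carrier_mat dS dS" and \<rho>Sp: "psd dS \<rho>S" and \<rho>St: "mtrace \<rho>S = 1"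
    using assms(4,5) by (auto simp: density_def psd_def)
  define U where "U g = of_mat dR (UR g)" for g
  have Uu: "unitary dR (U g)" if "g \<in> carrier G" for g
    unfolding U_def by (rule unitary_of_mat[OF URu[OF that]])
  define W where "W \<sigma> = E (kron \<sigma> \<rho>S)" for \<sigma>
  have Wc: "W \<sigma> \<in> carrier_mat (dR * dS) (dR * dS)" if "\<sigma> \<in> carrier_mat dR dR" for \<sigma>
    using assms(7) kron_carrier[OF that \<rho>Sc] by (simp add: channel_def W_def)
  have Wcov: "W (conj_by (UR g) \<sigma>) = conj_by (kron (UR g) (US g)) (W \<sigma>)"
    if "g \<in> carrier G" "\<sigma> \<in> carrier_mat dR dR" for g \<sigma>
  proof -
    have "conj_by (kron (UR g) (US g)) (kron \<sigma> \<rho>S) = kron (conj_by (UR g) \<sigma>) \<rho>S"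
      using assms(6) that by (simp add: conj_by_kron[OF URc[OF that(1)] USc[OF that(1)] that(2) \<rho>Sc] symmetric_state_def)
    then show ?thesis
      using assms(8) that kron_carrier[OF that(2) \<rho>Sc] unfolding covariant_def W_def by metis
  qed
  obtain M :: "(nat \<times> nat) set" and A where M: "finite M" and Af: "\<forall>m k. fits dR (A m k)"
    and A': "\<forall>\<sigma>\<in>carrier_mat dR dR. \<forall>k<dS. \<forall>l<dS.
      block dR dS k l (E (kron \<sigma> \<rho>S)) = (\<Sum>m\<in>M. A m k * of_mat dR \<sigma> * star (A m l))"
    using channel_stinespring[OF assms(7) \<rho>Sp] by blast
  have A: "block dR dS k l (E (kron \<sigma> \<rho>S)) = (\<Sum>m\<in>M. A m k * of_mat dR \<sigma> * star (A m l))"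
    if "\<sigma> \<in> carrier_mat dR dR" "k < dS" "l < dS" for \<sigma> k l
    using A' that by blast
  \<comment> \<open>Treating \<open>k\<close> as a further Kraus index traces out \<open>S\<close>:
    the family represents the marginal channel on \<open>R\<close>, which fixes
    \<open>\<rho>R\<close>.\<close>
  define J where "J = M \<times> {..<dS}"
  define B where "B = (\<lambda>(m,k). A m k)"
  have finJ: "finite J" using M by (simp add: J_def)
  have Bf: "fits dR (B j)" for j by (cases j) (simp add: B_def Af)
  have BF: "(\<Sum>j\<in>J. B j * of_mat dR \<sigma> * star (B j)) = of_mat dR (ptrace_S dR dS (W \<sigma>))"
    if "\<sigma> \<in> carrier_mat dR dR" for \<sigma>
  proof -
    have "(\<Sum>j\<in>J. B j * of_mat dR \<sigma> * star (B j)) = (\<Sum>m\<in>M. \<Sum>k<dS. A m k * of_mat dR \<sigma> * star (A m k))"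
      by (simp add: J_def B_def sum.cartesian_product case_prod_unfold)
    also have "\<dots> = (\<Sum>k<dS. \<Sum>m\<in>M. A m k * of_mat dR \<sigma> * star (A m k))" by (rule sum.swap)
    also have "\<dots> = of_mat dR (ptrace_S dR dS (W \<sigma>))"
      unfolding of_mat_ptrace_S W_def by (intro sum.cong refl) (simp add: A[OF that])
    finally show ?thesis .
  qed
  \<comment> \<open>Trace preservation of \<open>E\<close> and the unit trace of
    \<open>\<rho>S\<close>, dualised by testing against every matrix on \<open>R\<close>.\<close>
  have unital: "(\<Sum>j\<in>J. star (B j) * B j) = idm dR"
  proof -
    have "(\<Sum>j\<in>J. star (B j) * B j) - idm dR = 0"
    proof (rule tr_nondegenerate)
      show "fits dR ((\<Sum>j\<in>J. star (B j) * B j) - idm dR)"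
        by (intro fits_diff fits_sum fits_mult fits_idm) (simp_all add: Bf)
      fix S assume S: "fits dR S"
      then obtain X where X: "X \<in> carrier_mat dR dR" "of_mat dR X = S" by (rule of_mat_surj)
      have "tr (S * (star (B j) * B j)) = tr (B j * S * star (B j))" for j
        by (metis mult.assoc tr_commute)
      then have "tr (S * (\<Sum>j\<in>J. star (B j) * B j)) = tr (of_mat dR (ptrace_S dR dS (W X)))"
        using arg_cong[OF BF[OF X(1)], of tr] by (simp add: X(2) sum_distrib_left tr_sum)
      also have "\<dots> = mtrace (W X)" by (simp add: of_mat_ptrace_S tr_sum mtrace_block[OF Wc[OF X(1)]])
      also have "\<dots> = mtrace (kron X \<rho>S)"
        using assms(7) kron_carrier[OF X(1) \<rho>Sc] by (simp add: channel_def W_def)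
      also have "\<dots> = tr S"
        unfolding mtrace_kron[OF X(1) \<rho>Sc] \<rho>St X(2)[symmetric] tr_of_mat[OF X(1)] by simp
      finally show "tr (S * ((\<Sum>j\<in>J. star (B j) * B j) - idm dR)) = 0"
        using S by (simp add: right_diff_distrib tr_diff)
    qed
    then show ?thesis by simp
  qed
  obtain b0 where b0: "\<And>i j. i < dR \<Longrightarrow> j < dR \<Longrightarrow> \<rho>R $$ (i,j) = (\<Sum>k<dR. b0 i k * cnj (b0 j k))"
    using psd_matrix_factor[OF \<rho>Rp] by metis
  define b where "b = fm dR b0"
  have bf: "fits dR b" by (simp add: b_def)
  have bb: "b * star b = of_mat dR \<rho>R"
  proof (rule fmat_eqI_fits[of dR])
    fix i j assume ij: "i < dR" "j < dR"
    have "ent (b * star b) i j = (\<Sum>k<dR. b0 i k * cnj (b0 j k))"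
      unfolding ent_mult[OF disjI1[OF bf]] ent_star by (intro sum.cong refl) (use ij in \<open>simp add: b_def ent_fm\<close>)
    then show "ent (b * star b) i j = ent (of_mat dR \<rho>R) i j" by (simp add: ent_of_mat ij b0[OF ij])
  qed (simp_all add: bf)
  have proj: "\<forall>g\<in>carrier G. \<forall>h\<in>carrier G. \<exists>c. cmod c = 1 \<and> UR (g \<otimes>\<^bsub>G\<^esub> h) = c \<cdot>\<^sub>m (UR g * UR h)"
    using assms(2) unfolding proj_unitary_rep_def by (elim conjE)
  have Umult: "cj (U (g \<otimes>\<^bsub>G\<^esub> h)) X = cj (U g) (cj (U h) X)" if gh: "g \<in> carrier G" "h \<in> carrier G" for g h X
  proof -
    obtain c where c: "cmod c = 1" "UR (g \<otimes>\<^bsub>G\<^esub> h) = c \<cdot>\<^sub>m (UR g * UR h)"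
      using proj gh by blast
    then have "U (g \<otimes>\<^bsub>G\<^esub> h) = cs c (U g * U h)"
      by (simp add: U_def of_mat_smult[OF mult_carrier_mat[OF URc[OF gh(1)] URc[OF gh(2)]]]
          of_mat_mult[OF URc[OF gh(1)] URc[OF gh(2)]])
    then show ?thesis by (simp add: cj_cs_unit[OF c(1)] cj_cj)
  qed
  have leak: "tr (cj (U g) (b * star b) * (star (B i) * B j)) = tr (b * star b * (star (B i) * B j))"
    if g: "g \<in> carrier G" and ij: "i \<in> J" "j \<in> J" for g i j
  proof (rule information_leak_constant[where T=T and n=dR and U=U and J=J and A=B and e="\<one>\<^bsub>G\<^esub>"])
    show "unitary dR (U g)" if "g \<in> topspace T" for g using Uu that top by simp
    show "continuous_map T euclidean (\<lambda>g. ent (cj (U g) X) i j)" if X: "fits dR X" for X i j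
    proof -
      obtain Y where Y: "Y \<in> carrier_mat dR dR" "of_mat dR Y = X" using X by (rule of_mat_surj)
      have eq: "ent (cj (U g) X) i j = (if i < dR \<and> j < dR then conj_by (UR g) Y $$ (i,j) else 0)"
        if "g \<in> topspace T" for g
      proof -
        have g: "g \<in> carrier G" using that top by simp
        have "cj (U g) X = of_mat dR (conj_by (UR g) Y)"
          unfolding Y(2)[symmetric] U_def by (rule of_mat_conj_by[OF URc[OF g] Y(1), symmetric])
        then show ?thesis by (simp add: ent_of_mat)
      qed
      have "continuous_map T euclidean (\<lambda>g. if i < dR \<and> j < dR then conj_by (UR g) Y $$ (i,j) else 0)"
        using assms(2) Y(1) unfolding proj_unitary_rep_def by (cases "i < dR \<and> j < dR") simp_all
      then show ?thesis by (rule continuous_map_eq) (simp add: eq)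
    qed
    show "connected_space T" by (rule conn)
    show e: "\<one>\<^bsub>G\<^esub> \<in> topspace T" using top by simp
    have eU: "unitary dR (U \<one>\<^bsub>G\<^esub>)" by (rule Uu) simp
    show "cj (U \<one>\<^bsub>G\<^esub>) X = X" if X: "fits dR X" for X
    proof -
      \<comment> \<open>At the unit \<open>UR\<close> is determined only up to a phase; its
        conjugation is idempotent and invertible, hence trivial.\<close>
      have "cj (U \<one>\<^bsub>G\<^esub>) (cj (U \<one>\<^bsub>G\<^esub>) X) = cj (U \<one>\<^bsub>G\<^esub>) X" using Umult[of "\<one>\<^bsub>G\<^esub>" "\<one>\<^bsub>G\<^esub>" X] by simp
      then have "cj (star (U \<one>\<^bsub>G\<^esub>)) (cj (U \<one>\<^bsub>G\<^esub>) (cj (U \<one>\<^bsub>G\<^esub>) X)) = cj (star (U \<one>\<^bsub>G\<^esub>)) (cj (U \<one>\<^bsub>G\<^esub>) X)"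
        by (rule arg_cong)
      then show ?thesis using X eU by (simp add: cj_star_cj)
    qed
    show "\<exists>k\<in>topspace T. \<forall>X. fits dR X \<longrightarrow> cj (U g) (cj (U h) X) = cj (U k) X"
      if "g \<in> topspace T" "h \<in> topspace T" for g h
      using that Umult[of g h] top by (intro bexI[of _ "g \<otimes>\<^bsub>G\<^esub> h"]) simp_all
    show "\<exists>k\<in>topspace T. \<forall>X. fits dR X \<longrightarrow> cj (star (U g)) (cj (U h) X) = cj (U k) X"
      if "g \<in> topspace T" "h \<in> topspace T" for g h
    proof (intro bexI allI impI)
      have gh: "g \<in> carrier G" "h \<in> carrier G" using that top by auto
      then show "inv\<^bsub>G\<^esub> g \<otimes>\<^bsub>G\<^esub> h \<in> topspace T" using top by simp
      fix X assume X: "fits dR X"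
      \<comment> \<open>Cancelling \<open>U g\<close> from this factorisation of \<open>h\<close>
        avoids comparing the adjoint of \<open>U g\<close> with the value of \<open>U\<close> at the
        inverse.\<close>
      have "g \<otimes>\<^bsub>G\<^esub> (inv\<^bsub>G\<^esub> g \<otimes>\<^bsub>G\<^esub> h) = h" using gh by (simp flip: G.m_assoc)
      then have "cj (U h) X = cj (U g) (cj (U (inv\<^bsub>G\<^esub> g \<otimes>\<^bsub>G\<^esub> h)) X)"
        using Umult[of g "inv\<^bsub>G\<^esub> g \<otimes>\<^bsub>G\<^esub> h" X] gh by simp
      then show "cj (star (U g)) (cj (U h) X) = cj (U (inv\<^bsub>G\<^esub> g \<otimes>\<^bsub>G\<^esub> h)) X"
        using gh X Uu by (simp add: cj_star_cj[where n=dR])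
    qed
    show "finite J" by (rule finJ)
    show "fits dR (B j)" for j by (rule Bf)
    show "(\<Sum>j\<in>J. star (B j) * B j) = idm dR" by (rule unital)
    show "fits dR b" by (rule bf)
    show "(\<Sum>j\<in>J. B j * (b * star b) * star (B j)) = b * star b"
      unfolding bb BF[OF \<rho>Rc] W_def assms(9) ..
    show "(\<Sum>j\<in>J. B j * cj (U g) X * star (B j)) = cj (U g) (\<Sum>j\<in>J. B j * X * star (B j))"
      if g: "g \<in> topspace T" and X: "fits dR X" for g X
    proof -
      have g: "g \<in> carrier G" using that top by simp
      obtain Y where Y: "Y \<in> carrier_mat dR dR" "of_mat dR Y = X" using X by (rule of_mat_surj)
      have "(\<Sum>j\<in>J. B j * cj (U g) X * star (B j)) = of_mat dR (ptrace_S dR dS (W (conj_by (UR g) Y)))"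
        unfolding Y(2)[symmetric] U_def of_mat_conj_by[OF URc[OF g] Y(1), symmetric]
        by (rule BF[OF conj_by_carrier[OF URc[OF g] Y(1)]])
      also have "\<dots> = cj (U g) (of_mat dR (ptrace_S dR dS (W Y)))"
        unfolding Wcov[OF g Y(1)] U_def by (rule ptrace_S_conj_kron[OF URc[OF g] USu[OF g] Wc[OF Y(1)]])
      finally show ?thesis unfolding BF[OF Y(1), symmetric] Y(2) .
    qed
    show "g \<in> topspace T" using g top by simp
  qed (use ij in auto)
  show ?thesis
    unfolding symmetric_state_def
  proof
    fix g assume g: "g \<in> carrier G"
    define \<rho>' where "\<rho>' = conj_by (UR g) \<rho>R"
    have \<rho>'c: "\<rho>' \<in> carrier_mat dR dR" unfolding \<rho>'_def by (rule conj_by_carrier[OF URc[OF g] \<rho>Rc])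
    have o\<rho>': "of_mat dR \<rho>' = cj (U g) (b * star b)"
      unfolding \<rho>'_def U_def bb by (rule of_mat_conj_by[OF URc[OF g] \<rho>Rc])
    \<comment> \<open>Cyclicity brings the two operators together, so the entries on
      \<open>S\<close> are sums of exactly the expectation values that \<open>leak\<close>
      controls.\<close>
    have entry: "ptrace_R dR dS (W \<sigma>) $$ (k,l) = (\<Sum>m\<in>M. tr (of_mat dR \<sigma> * (star (B (m,l)) * B (m,k))))"
      if "\<sigma> \<in> carrier_mat dR dR" "k < dS" "l < dS" for \<sigma> k l
    proof -
      have "tr (A m k * of_mat dR \<sigma> * star (A m l)) = tr (of_mat dR \<sigma> * (star (A m l) * A m k))" for m
        by (metis mult.assoc tr_commute)
      then show ?thesis
        by (simp add: ptrace_R_entry[OF that(2,3)] W_def A[OF that] tr_sum B_def)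
    qed
    \<comment> \<open>Since \<open>\<rho>S\<close> is symmetric, rotating the output on
      \<open>S\<close> amounts to rotating the input on \<open>R\<close> alone.\<close>
    have "conj_by (US g) (ptrace_R dR dS (W \<rho>R)) = ptrace_R dR dS (W \<rho>')"
      unfolding \<rho>'_def Wcov[OF g \<rho>Rc]
      by (rule ptrace_R_conj_kron[OF URu[OF g] USc[OF g] Wc[OF \<rho>Rc], symmetric])
    also have "\<dots> = ptrace_R dR dS (W \<rho>R)"
    proof (rule eq_matI)
      fix k l assume "k < dim_row (ptrace_R dR dS (W \<rho>R))" "l < dim_col (ptrace_R dR dS (W \<rho>R))"
      then have kl: "k < dS" "l < dS" by (simp_all add: ptrace_R_def)
      show "ptrace_R dR dS (W \<rho>') $$ (k,l) = ptrace_R dR dS (W \<rho>R) $$ (k,l)"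
        unfolding entry[OF \<rho>'c kl] entry[OF \<rho>Rc kl] o\<rho>' bb[symmetric]
        by (intro sum.cong refl leak g) (use kl in \<open>simp_all add: J_def\<close>)
    qed (simp_all add: ptrace_R_def)
    finally show "conj_by (US g) (ptrace_R dR dS (E (kron \<rho>R \<rho>S))) = ptrace_R dR dS (E (kron \<rho>R \<rho>S))"
      by (simp add: W_def)
  qed
qed

end
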